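(* Let $R$ be a semiprime left Goldie ring and $\mathcal{N}=\{S\in\max\mathbb{L}_l(R):\mathcal{C}_R\subseteq S\}$. Then $\mathcal{N}=\max\mathrm{Den}_l(R)=\{\mathcal{C}(\mathfrak{p}):\mathfrak{p}\in\min(R)\}$, where $\mathcal{C}(\mathfrak{p})=\{c\in R: c+\mathfrak{p}\in\mathcal{C}_{R/\mathfrak{p}}\}$.
   Context: Rings are associative with $1$. $\mathcal{C}_A$ denotes the set of regular elements (non-zero-divisors on both sides) of a ring $A$; $\min(R)$ the set of minimal prime ideals of $R$. Multiplicative set: $SS\subseteq S$, $1\in S$, $0\notin S$. Left denominator set: $Sr\cap Rs\ne\emptyset$ for all $r\in R,s\in S$, and $rs=0$ ($s\in S$) implies $tr=0$ for some $t\in S$; $\max\mathrm{Den}_l(R)$ is the set of maximal left denominator sets w.r.t. inclusion. $R\langle S^{-1}\rangle=R\langle X_S\rangle/I_S$ with $R\langle X_S\rangle$ freely generated by $R$ and noncommuting indeterminates $x_s$ ($s\in S$) and $I_S$ generated by $sx_s-1,x_ss-1$. $S$ is left localizable if $R\langle S^{-1}\rangle\neq0$ and every element has the form $(x_s+I_S)(r+I_S)$; $\mathbb{L}_l(R)$ is the set of left localizable sets and $\max\mathbb{L}_l(R)$ its maximal elements w.r.t. inclusion. *)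

theory Defs
  imports Main
begin

definition left_ideal :: "'a::ring_1 set \<Rightarrow> bool" where
  "left_ideal L \<longleftrightarrow> 0 \<in> L \<and> (\<forall>x\<in>L. \<forall>y\<in>L. x + y \<in> L) \<and> (\<forall>x\<in>L. - x \<in> L)
     \<and> (\<forall>r x. x \<in> L \<longrightarrow> r * x \<in> L)"

definition two_sided_ideal :: "'a::ring_1 set \<Rightarrow> bool" where
  "two_sided_ideal I \<longleftrightarrow> left_ideal I \<and> (\<forall>r x. x \<in> I \<longrightarrow> x * r \<in> I)"

text \<open>P is prime: proper ideal, and for ideals A, B with AB contained in P,
  A or B is contained in P (AB is generated by the products a*b).\<close>
definition prime_ideal :: "'a::ring_1 set \<Rightarrow> bool" where
  "prime_ideal P \<longleftrightarrow> two_sided_ideal P \<and> P \<noteq> UNIV \<and>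
     (\<forall>A B. two_sided_ideal A \<longrightarrow> two_sided_ideal B \<longrightarrow>
        (\<forall>a\<in>A. \<forall>b\<in>B. a * b \<in> P) \<longrightarrow> A \<subseteq> P \<or> B \<subseteq> P)"

definition min_primes :: "'a::ring_1 set set" where
  "min_primes = {P. prime_ideal P \<and> \<not> (\<exists>Q. prime_ideal Q \<and> Q \<subset> P)}"

definition nilpotent_ideal :: "'a::ring_1 set \<Rightarrow> bool" where
  "nilpotent_ideal I \<longleftrightarrow> (\<exists>n>0. \<forall>xs. length xs = n \<longrightarrow> set xs \<subseteq> I \<longrightarrow> prod_list xs = 0)"

definition semiprime_ring :: "'a::ring_1 itself \<Rightarrow> bool" where
  "semiprime_ring _ \<longleftrightarrow> (\<forall>I::'a set. two_sided_ideal I \<longrightarrow> nilpotent_ideal I \<longrightarrow> I = {0})"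

definition left_ann :: "'a::ring_1 set \<Rightarrow> 'a set" where
  "left_ann X = {r. \<forall>x\<in>X. r * x = 0}"

definition acc_left_annihilators :: "'a::ring_1 itself \<Rightarrow> bool" where
  "acc_left_annihilators _ \<longleftrightarrow>
     \<not> (\<exists>f :: nat \<Rightarrow> 'a set. (\<forall>n. \<exists>X. f n = left_ann X) \<and> (\<forall>n. f n \<subset> f (Suc n)))"

definition sum_upto :: "(nat \<Rightarrow> 'a::ring_1 set) \<Rightarrow> nat \<Rightarrow> 'a set" where
  "sum_upto L n = {(\<Sum>i<n. x i) | x. \<forall>i<n. x i \<in> L i}"

definition finite_left_uniform_dim :: "'a::ring_1 itself \<Rightarrow> bool" where
  "finite_left_uniform_dim _ \<longleftrightarrow>
     \<not> (\<exists>L :: nat \<Rightarrow> 'a set. (\<forall>n. left_ideal (L n) \<and> L n \<noteq> {0}) \<and>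
           (\<forall>n. L n \<inter> sum_upto L n = {0}))"

definition left_Goldie :: "'a::ring_1 itself \<Rightarrow> bool" where
  "left_Goldie R \<longleftrightarrow> acc_left_annihilators R \<and> finite_left_uniform_dim R"

definition regular_elems :: "'a::ring_1 set" where
  "regular_elems = {c. (\<forall>x. c * x = 0 \<longrightarrow> x = 0) \<and> (\<forall>x. x * c = 0 \<longrightarrow> x = 0)}"

text \<open>C(p) = {c. c + p is regular in R/p}, written out on representatives.\<close>
definition C_mod :: "'a::ring_1 set \<Rightarrow> 'a set" where
  "C_mod P = {c. (\<forall>x. c * x \<in> P \<longrightarrow> x \<in> P) \<and> (\<forall>x. x * c \<in> P \<longrightarrow> x \<in> P)}"

definition mult_set :: "'a::ring_1 set \<Rightarrow> bool" where
  "mult_set S \<longleftrightarrow> 1 \<in> S \<and> 0 \<notin> S \<and> (\<forall>s\<in>S. \<forall>t\<in>S. s * t \<in> S)"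

definition left_denom_set :: "'a::ring_1 set \<Rightarrow> bool" where
  "left_denom_set S \<longleftrightarrow> mult_set S \<and>
     (\<forall>r. \<forall>s\<in>S. \<exists>t\<in>S. \<exists>r'. t * r = r' * s) \<and>
     (\<forall>r. \<forall>s\<in>S. r * s = 0 \<longrightarrow> (\<exists>t\<in>S. t * r = 0))"

definition max_Den_l :: "'a::ring_1 set set" where
  "max_Den_l = {S. left_denom_set S \<and> \<not> (\<exists>T. left_denom_set T \<and> S \<subset> T)}"

section \<open>The ring R<S^-1> = R<X_S>/I_S, given by a presentation\<close>

text \<open>Terms of the free ring generated by (elements of) R and indeterminates x_s.\<close>
datatype 'a rterm = RConst 'a | X 'a | RZero | ROne | RAdd "'a rterm" "'a rterm"
  | RMul "'a rterm" "'a rterm" | RNeg "'a rterm"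

fun xvars :: "'a rterm \<Rightarrow> 'a set" where
  "xvars (X s) = {s}"
| "xvars (RAdd a b) = xvars a \<union> xvars b"
| "xvars (RMul a b) = xvars a \<union> xvars b"
| "xvars (RNeg a) = xvars a"
| "xvars _ = {}"

text \<open>Equality in R<S^-1>: the congruence generated by the ring axioms, the
  ring structure of R (R is a subring of the free R-ring R<X_S>) and the
  relations s x_s = 1 = x_s s for s in S.\<close>
inductive loc_eq :: "'a::ring_1 set \<Rightarrow> 'a rterm \<Rightarrow> 'a rterm \<Rightarrow> bool" for S where
  refl: "loc_eq S a a"
| sym: "loc_eq S a b \<Longrightarrow> loc_eq S b a"
| trans: "loc_eq S a b \<Longrightarrow> loc_eq S b c \<Longrightarrow> loc_eq S a c"
| cong_add: "loc_eq S a a' \<Longrightarrow> loc_eq S b b' \<Longrightarrow> loc_eq S (RAdd a b) (RAdd a' b')"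
| cong_mul: "loc_eq S a a' \<Longrightarrow> loc_eq S b b' \<Longrightarrow> loc_eq S (RMul a b) (RMul a' b')"
| cong_neg: "loc_eq S a a' \<Longrightarrow> loc_eq S (RNeg a) (RNeg a')"
| add_assoc: "loc_eq S (RAdd (RAdd a b) c) (RAdd a (RAdd b c))"
| add_comm: "loc_eq S (RAdd a b) (RAdd b a)"
| add_zero: "loc_eq S (RAdd a RZero) a"
| add_neg: "loc_eq S (RAdd a (RNeg a)) RZero"
| mul_assoc: "loc_eq S (RMul (RMul a b) c) (RMul a (RMul b c))"
| mul_one_l: "loc_eq S (RMul ROne a) a"
| mul_one_r: "loc_eq S (RMul a ROne) a"
| distrib_l: "loc_eq S (RMul a (RAdd b c)) (RAdd (RMul a b) (RMul a c))"
| distrib_r: "loc_eq S (RMul (RAdd a b) c) (RAdd (RMul a c) (RMul b c))"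
| const_add: "loc_eq S (RConst (r + r')) (RAdd (RConst r) (RConst r'))"
| const_mul: "loc_eq S (RConst (r * r')) (RMul (RConst r) (RConst r'))"
| const_one: "loc_eq S (RConst 1) ROne"
| const_zero: "loc_eq S (RConst 0) RZero"
| const_neg: "loc_eq S (RConst (- r)) (RNeg (RConst r))"
| inv_r: "s \<in> S \<Longrightarrow> loc_eq S (RMul (RConst s) (X s)) ROne"
| inv_l: "s \<in> S \<Longrightarrow> loc_eq S (RMul (X s) (RConst s)) ROne"

text \<open>S is left localizable: R<S^-1> is nonzero and every element (a term in R and
  the x_s, s in S) equals x_s r for some s in S and r in R.\<close>
definition left_localizable :: "'a::ring_1 set \<Rightarrow> bool" where
  "left_localizable S \<longleftrightarrow> mult_set S \<and> \<not> loc_eq S ROne RZero \<and>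
     (\<forall>e. xvars e \<subseteq> S \<longrightarrow> (\<exists>s\<in>S. \<exists>r. loc_eq S e (RMul (X s) (RConst r))))"

definition max_L_l :: "'a::ring_1 set set" where
  "max_L_l = {S. left_localizable S \<and> \<not> (\<exists>T. left_localizable T \<and> S \<subset> T)}"

end

theory Submission
  imports Defs
begin

text \<open>The minimal primes are the annihilators \<open>P = ann(U)\<close> of the minimal nonzero annihilator
  ideals \<open>U\<close>, and \<open>C(P)\<close> consists of the elements acting regularly on \<open>U\<close> from both sides. By
  Goldie's theorem the essential left ideal \<open>U + P\<close> contains a regular element, which yields the Ore
  condition for \<open>C(P)\<close> and incomparability of the sets \<open>C(P)\<close>. Conversely, for a left denominator set,
  or a left localizable set over the regular elements, let \<open>I\<close> be the kernel of the localization map.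
  It contains no regular element, so \<open>ann(I) \<noteq> 0\<close> contains some minimal \<open>U\<close>; as
  \<open>U \<inter> I = 0\<close>, the given set acts regularly on \<open>U\<close> and lies in \<open>C(ann(U))\<close>.\<close>

section \<open>Ideals and finite uniform dimension\<close>

text \<open>Regular elements are kept out of the kernel \<open>I\<close> in two different ways. For
  a denominator set, \<open>t * r = 0\<close> with \<open>r\<close> regular forces
  \<open>t = 0\<close>. A localizable set offers no such elementwise description of its kernel, and
  this is where \<open>regular_elems \<subseteq> S\<close> enters: a regular element of the kernel
  would become zero and invertible at once. In the other direction the obstacle is that
  \<open>R<S^-1>\<close> exists only as terms modulo a congruence, so that it is nonzero cannot be
  read off; derivations are therefore tested against partial maps on \<open>U\<close>, which need
  not be defined everywhere.\<close>

lemma left_idealD: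
  assumes "left_ideal L"
  shows "0 \<in> L" "x \<in> L \<Longrightarrow> y \<in> L \<Longrightarrow> x + y \<in> L" "x \<in> L \<Longrightarrow> - x \<in> L"
    "x \<in> L \<Longrightarrow> r * x \<in> L"
  using assms by (auto simp: left_ideal_def)

lemma left_ideal_diff:
  assumes "left_ideal L" "x \<in> L" "y \<in> L"
  shows "x - y \<in> L"
  using left_idealD(2)[OF assms(1,2) left_idealD(3)[OF assms(1,3)]] by simp

lemma left_ideal_sum:
  assumes "left_ideal L" "\<And>i. i \<in> A \<Longrightarrow> x i \<in> L"
  shows "sum x A \<in> L"
  using assms(2)
  by (induction A rule: infinite_finite_induct) (auto intro: left_idealD[OF assms(1)])

lemma left_ideal_UNIV: "left_ideal UNIV"
  by (simp add: left_ideal_def)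

lemma two_sided_ideal_UNIV: "two_sided_ideal UNIV"
  by (simp add: two_sided_ideal_def left_ideal_UNIV)

lemma left_ideal_left_ann: "left_ideal (left_ann Y)"
  by (auto simp: left_ideal_def left_ann_def distrib_right mult.assoc)

lemma left_ideal_Int: "left_ideal I \<Longrightarrow> left_ideal J \<Longrightarrow> left_ideal (I \<inter> J)"
  by (auto simp: left_ideal_def)

lemma two_sided_ideal_Int:
  "two_sided_ideal I \<Longrightarrow> two_sided_ideal J \<Longrightarrow> two_sided_ideal (I \<inter> J)"
  by (auto simp: two_sided_ideal_def left_ideal_Int)

lemma left_ideal_right_multiples:
  assumes "left_ideal L"
  shows "left_ideal ((\<lambda>x. x * a) ` L)"
proof -
  note LD = left_idealD[OF assms]
  have "0 * a \<in> (\<lambda>x. x * a) ` L" using LD(1) by (rule imageI)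
  moreover have "x * a + y * a \<in> (\<lambda>x. x * a) ` L" if "x \<in> L" "y \<in> L" for x y
    using imageI[OF LD(2)[OF that], of "\<lambda>x. x * a"] by (simp add: distrib_right)
  moreover have "- (x * a) \<in> (\<lambda>x. x * a) ` L" if "x \<in> L" for x
    using imageI[OF LD(3)[OF that], of "\<lambda>x. x * a"] by simp
  moreover have "r * (x * a) \<in> (\<lambda>x. x * a) ` L" if "x \<in> L" for r x
    using imageI[OF LD(4)[OF that], of "\<lambda>x. x * a"] by (simp add: mult.assoc)
  ultimately show ?thesis unfolding left_ideal_def by auto
qed

lemma left_ideal_principal: "left_ideal (range (\<lambda>r. r * a))"
  using left_ideal_right_multiples[OF left_ideal_UNIV] .

lemma two_sided_ideal_left_ann:
  assumes "two_sided_ideal I"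
  shows "two_sided_ideal (left_ann I)"
  using assms left_ideal_left_ann[of I]
  by (auto simp: two_sided_ideal_def left_ideal_def left_ann_def mult.assoc)

lemma C_modD:
  assumes "c \<in> C_mod P"
  shows "c * x \<in> P \<Longrightarrow> x \<in> P" "x * c \<in> P \<Longrightarrow> x \<in> P"
  by (rule assms[unfolded C_mod_def mem_Collect_eq, THEN conjunct1, THEN spec, THEN mp], assumption,
      rule assms[unfolded C_mod_def mem_Collect_eq, THEN conjunct2, THEN spec, THEN mp], assumption)

lemma C_modI:
  assumes "\<And>x. c * x \<in> P \<Longrightarrow> x \<in> P" "\<And>x. x * c \<in> P \<Longrightarrow> x \<in> P"
  shows "c \<in> C_mod P"
  unfolding C_mod_def mem_Collect_eq by (intro conjI allI impI; erule assms)

definition essential_in :: "'a::ring_1 set \<Rightarrow> 'a set \<Rightarrow> bool" where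
  "essential_in U D \<longleftrightarrow> (\<forall>u\<in>U. u \<noteq> 0 \<longrightarrow> (\<exists>r. r * u \<in> D \<and> r * u \<noteq> 0))"

lemma essential_inE:
  assumes "essential_in U D" "u \<in> U" "u \<noteq> 0"
  obtains r where "r * u \<in> D" "r * u \<noteq> 0"
  using assms by (auto simp: essential_in_def)

text \<open>The chain \<open>K\<close> certifies independence: all terms after index
  \<open>m\<close> lie in \<open>K (Suc m)\<close>, so solving a relation for its lowest term puts
  that term into \<open>A m \<inter> K (Suc m)\<close>. Both infinite direct sums below, from powers
  of an element and from annihilators, arise in this way.\<close>

lemma uniform_dim_chain:
  fixes K A :: "nat \<Rightarrow> 'a::ring_1 set"
  assumes dim: "finite_left_uniform_dim TYPE('a)"
    and K: "\<And>n. left_ideal (K n)" "\<And>n. K (Suc n) \<subseteq> K n"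
    and A: "\<And>n. left_ideal (A n)" "\<And>n. A n \<noteq> {0}" "\<And>n. A n \<subseteq> K n"
    and AK: "\<And>n. A n \<inter> K (Suc n) \<subseteq> {0}"
  shows False
proof -
  have anti: "K n \<subseteq> K m" if "m \<le> n" for m n
    using lift_Suc_antimono_le[of K] K(2) that by blast
  have indep: "A n \<inter> sum_upto A n = {0}" for n
  proof
    show "A n \<inter> sum_upto A n \<subseteq> {0}"
    proof
      fix y assume "y \<in> A n \<inter> sum_upto A n"
      then obtain x where y: "y \<in> A n" "y = (\<Sum>i<n. x i)" and x: "\<And>i. i < n \<Longrightarrow> x i \<in> A i"
        by (auto simp: sum_upto_def)
      have zero: "(\<Sum>i<m. x i) = 0" if "m \<le> n" for m
        using that
      proof (induction m)
        case (Suc m)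
        then have "m < n" and IH: "(\<Sum>i<m. x i) = 0" by auto
        have "sum x {..<n} = sum x {..<Suc m} + sum x {Suc m..<n}"
          using Suc.prems sum.atLeastLessThan_concat[of 0 "Suc m" n x]
          by (simp add: lessThan_atLeast0 del: sum.lessThan_Suc)
        then have "x m = y - sum x {Suc m..<n}"
          using IH y(2) by simp
        moreover have "y \<in> K (Suc m)"
          using y(1) A(3) anti[of "Suc m" n] Suc.prems by blast
        moreover have "sum x {Suc m..<n} \<in> K (Suc m)"
        proof (rule left_ideal_sum[OF K(1)])
          fix i assume "i \<in> {Suc m..<n}"
          then show "x i \<in> K (Suc m)" using x[of i] A(3)[of i] anti[of "Suc m" i] by auto
        qed
        ultimately have "x m \<in> K (Suc m)" by (simp add: left_ideal_diff[OF K(1)])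
        then have "x m = 0" using AK[of m] x[OF \<open>m < n\<close>] by blast
        then show ?case using IH by simp
      qed simp
      then show "y \<in> {0}" using y(2) by simp
    qed
    have "(0::'a) = (\<Sum>i<n. (\<lambda>_. 0) i)" "\<forall>i<n. (\<lambda>_. 0) i \<in> A i"
      using left_idealD(1)[OF A(1)] by auto
    then have "0 \<in> sum_upto A n" unfolding sum_upto_def by blast
    then show "{0} \<subseteq> A n \<inter> sum_upto A n" using left_idealD(1)[OF A(1)] by auto
  qed
  show False
    using dim A(1,2) indep unfolding finite_left_uniform_dim_def by blast
qed

text \<open>If \<open>Ru\<close> met \<open>Us\<close> only in zero, the left ideals
  \<open>R u s^n\<close> would form an infinite direct sum: each lies in \<open>U s^n\<close> and
  meets \<open>U s^(n+1)\<close> trivially, because \<open>s^n\<close> cancels on the right of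
  \<open>U\<close>.\<close>

lemma essential_in_right_multiples:
  fixes U :: "'a::ring_1 set"
  assumes dim: "finite_left_uniform_dim TYPE('a)"
    and U: "left_ideal U" "\<And>x. x \<in> U \<Longrightarrow> x * s \<in> U"
    and reg: "\<And>x. x \<in> U \<Longrightarrow> x * s = 0 \<Longrightarrow> x = 0"
  shows "essential_in U ((\<lambda>x. x * s) ` U)"
  unfolding essential_in_def
proof (intro ballI impI, rule ccontr)
  fix u assume u: "u \<in> U" "u \<noteq> 0" and "\<nexists>r. r * u \<in> (\<lambda>x. x * s) ` U \<and> r * u \<noteq> 0"
  then have disj: "r * u = 0" if "r * u = x * s" "x \<in> U" for r x
    using that by auto
  have reg_pow: "x = 0" if "x \<in> U" "x * s ^ n = 0" for x n
    using that
  proof (induction n arbitrary: x)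
    case (Suc n)
    then have "x * s * s ^ n = 0" by (simp add: mult.assoc)
    then show ?case using Suc reg U(2) by blast
  qed simp
  show False
  proof (rule uniform_dim_chain[OF dim, of "\<lambda>n. (\<lambda>x. x * s ^ n) ` U" "\<lambda>n. range (\<lambda>r. r * (u * s ^ n))"])
    fix n
    show "left_ideal ((\<lambda>x. x * s ^ n) ` U)" by (rule left_ideal_right_multiples[OF U(1)])
    show "(\<lambda>x. x * s ^ Suc n) ` U \<subseteq> (\<lambda>x. x * s ^ n) ` U"
      using U(2) by (auto simp: mult.assoc[symmetric])
    show "left_ideal (range (\<lambda>r. r * (u * s ^ n)))" by (rule left_ideal_principal)
    have "1 * (u * s ^ n) \<noteq> 0" using reg_pow u by auto
    then show "range (\<lambda>r. r * (u * s ^ n)) \<noteq> {0}" by blast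
    show "range (\<lambda>r. r * (u * s ^ n)) \<subseteq> (\<lambda>x. x * s ^ n) ` U"
      using left_idealD(4)[OF U(1) u(1)] by (auto simp: mult.assoc[symmetric])
    show "range (\<lambda>r. r * (u * s ^ n)) \<inter> (\<lambda>x. x * s ^ Suc n) ` U \<subseteq> {0}"
    proof
      fix y assume "y \<in> range (\<lambda>r. r * (u * s ^ n)) \<inter> (\<lambda>x. x * s ^ Suc n) ` U"
      then obtain r x where y: "y = r * (u * s ^ n)" "y = x * s ^ Suc n" "x \<in> U" by blast
      then have "(r * u - x * s) * s ^ n = 0" by (simp add: algebra_simps)
      moreover have "r * u - x * s \<in> U"
        using left_ideal_diff[OF U(1)] left_idealD(4)[OF U(1) u(1)] U(2)[OF y(3)] by blast
      ultimately have "r * u = x * s" using reg_pow[of "r * u - x * s" n] by simp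
      then have "r * u = 0" using disj y(3) by blast
      then show "y \<in> {0}" using y(1) by (simp add: mult.assoc[symmetric])
    qed
  qed
qed

lemma acc_left_annihilators_maximal:
  fixes \<A> :: "'a::ring_1 set set"
  assumes acc: "acc_left_annihilators TYPE('a)"
    and ann: "\<And>A. A \<in> \<A> \<Longrightarrow> \<exists>Y. A = left_ann Y" and ne: "\<A> \<noteq> {}"
  obtains M where "M \<in> \<A>" "\<And>A. A \<in> \<A> \<Longrightarrow> M \<subseteq> A \<Longrightarrow> A = M"
proof (rule ccontr)
  assume "\<not> thesis"
  then have step: "\<exists>B. B \<in> \<A> \<and> A \<subset> B" if "A \<in> \<A>" for A
    using that \<open>\<And>M. M \<in> \<A> \<Longrightarrow> (\<And>A. A \<in> \<A> \<Longrightarrow> M \<subseteq> A \<Longrightarrow> A = M) \<Longrightarrow> thesis\<close> by blast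
  have "\<exists>f. \<forall>n::nat. f n \<in> \<A> \<and> f n \<subset> f (Suc n)"
    by (rule dependent_nat_choice) (use ne step in blast)+
  then obtain f :: "nat \<Rightarrow> 'a set" where f: "\<forall>n. f n \<in> \<A> \<and> f n \<subset> f (Suc n)" ..
  then have "(\<forall>n. \<exists>Y. f n = left_ann Y) \<and> (\<forall>n. f n \<subset> f (Suc n))" using ann by simp
  then show False using acc unfolding acc_left_annihilators_def by (elim notE) (rule exI)
qed

section \<open>The localization given by generators and relations\<close>

declare loc_eq.trans [trans]

text \<open>The quotient is not a type with a ring instance, so the elementary ring identities are
  derived from the rules of the congruence.\<close>

lemma loc_eq_add_cancel:
  assumes "loc_eq S (RAdd a a) a"
  shows "loc_eq S a RZero"
proof -
  have "loc_eq S a (RAdd a RZero)" by (rule loc_eq.sym[OF loc_eq.add_zero])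
  also have "loc_eq S \<dots> (RAdd a (RAdd a (RNeg a)))"
    by (intro loc_eq.cong_add loc_eq.refl loc_eq.sym[OF loc_eq.add_neg])
  also have "loc_eq S \<dots> (RAdd (RAdd a a) (RNeg a))" by (rule loc_eq.sym[OF loc_eq.add_assoc])
  also have "loc_eq S \<dots> (RAdd a (RNeg a))" by (intro loc_eq.cong_add assms loc_eq.refl)
  also have "loc_eq S \<dots> RZero" by (rule loc_eq.add_neg)
  finally show ?thesis .
qed

lemma loc_eq_mult_zero: "loc_eq S (RMul a RZero) RZero"
proof (rule loc_eq_add_cancel)
  have "loc_eq S (RAdd (RMul a RZero) (RMul a RZero)) (RMul a (RAdd RZero RZero))"
    by (rule loc_eq.sym[OF loc_eq.distrib_l])
  also have "loc_eq S \<dots> (RMul a RZero)" by (intro loc_eq.cong_mul loc_eq.refl loc_eq.add_zero)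
  finally show "loc_eq S (RAdd (RMul a RZero) (RMul a RZero)) (RMul a RZero)" .
qed

lemma loc_eq_zero_mult: "loc_eq S (RMul RZero a) RZero"
proof (rule loc_eq_add_cancel)
  have "loc_eq S (RAdd (RMul RZero a) (RMul RZero a)) (RMul (RAdd RZero RZero) a)"
    by (rule loc_eq.sym[OF loc_eq.distrib_r])
  also have "loc_eq S \<dots> (RMul RZero a)" by (intro loc_eq.cong_mul loc_eq.refl loc_eq.add_zero)
  finally show "loc_eq S (RAdd (RMul RZero a) (RMul RZero a)) (RMul RZero a)" .
qed

lemma loc_eq_neg_unique:
  assumes "loc_eq S (RAdd a b) RZero"
  shows "loc_eq S (RNeg a) b"
proof -
  have "loc_eq S (RNeg a) (RAdd (RNeg a) RZero)" by (rule loc_eq.sym[OF loc_eq.add_zero])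
  also have "loc_eq S \<dots> (RAdd (RNeg a) (RAdd a b))"
    by (intro loc_eq.cong_add loc_eq.refl loc_eq.sym[OF assms])
  also have "loc_eq S \<dots> (RAdd (RAdd (RNeg a) a) b)" by (rule loc_eq.sym[OF loc_eq.add_assoc])
  also have "loc_eq S \<dots> (RAdd (RAdd a (RNeg a)) b)"
    by (intro loc_eq.cong_add loc_eq.refl loc_eq.add_comm)
  also have "loc_eq S \<dots> (RAdd RZero b)" by (intro loc_eq.cong_add loc_eq.refl loc_eq.add_neg)
  also have "loc_eq S \<dots> (RAdd b RZero)" by (rule loc_eq.add_comm)
  also have "loc_eq S \<dots> b" by (rule loc_eq.add_zero)
  finally show ?thesis .
qed

lemma loc_eq_neg_mult: "loc_eq S (RNeg (RMul a b)) (RMul a (RNeg b))"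
proof (rule loc_eq_neg_unique)
  have "loc_eq S (RAdd (RMul a b) (RMul a (RNeg b))) (RMul a (RAdd b (RNeg b)))"
    by (rule loc_eq.sym[OF loc_eq.distrib_l])
  also have "loc_eq S \<dots> (RMul a RZero)" by (intro loc_eq.cong_mul loc_eq.refl loc_eq.add_neg)
  also have "loc_eq S \<dots> RZero" by (rule loc_eq_mult_zero)
  finally show "loc_eq S (RAdd (RMul a b) (RMul a (RNeg b))) RZero" .
qed

text \<open>An Ore equation is what carries a denominator from the right of a numerator to its left:
  \<open>r t^-1 = u^-1 q\<close>.\<close>

lemma loc_eq_const_X:
  assumes "t \<in> S" "u \<in> S" "u * r = q * t"
  shows "loc_eq S (RMul (RConst r) (X t)) (RMul (X u) (RConst q))"
proof -
  have "loc_eq S (RMul (RConst r) (X t)) (RMul ROne (RMul (RConst r) (X t)))"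
    by (rule loc_eq.sym[OF loc_eq.mul_one_l])
  also have "loc_eq S \<dots> (RMul (RMul (X u) (RConst u)) (RMul (RConst r) (X t)))"
    by (intro loc_eq.cong_mul loc_eq.refl loc_eq.sym[OF loc_eq.inv_l] assms)
  also have "loc_eq S \<dots> (RMul (X u) (RMul (RConst u) (RMul (RConst r) (X t))))"
    by (rule loc_eq.mul_assoc)
  also have "loc_eq S \<dots> (RMul (X u) (RMul (RMul (RConst u) (RConst r)) (X t)))"
    by (intro loc_eq.cong_mul loc_eq.refl loc_eq.sym[OF loc_eq.mul_assoc])
  also have "loc_eq S \<dots> (RMul (X u) (RMul (RConst (u * r)) (X t)))"
    by (intro loc_eq.cong_mul loc_eq.refl loc_eq.sym[OF loc_eq.const_mul])
  also have "loc_eq S \<dots> (RMul (X u) (RMul (RMul (RConst q) (RConst t)) (X t)))"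
    unfolding assms(3) by (intro loc_eq.cong_mul loc_eq.refl loc_eq.const_mul)
  also have "loc_eq S \<dots> (RMul (X u) (RMul (RConst q) (RMul (RConst t) (X t))))"
    by (intro loc_eq.cong_mul loc_eq.refl loc_eq.mul_assoc)
  also have "loc_eq S \<dots> (RMul (X u) (RMul (RConst q) ROne))"
    by (intro loc_eq.cong_mul loc_eq.refl loc_eq.inv_r assms)
  also have "loc_eq S \<dots> (RMul (X u) (RConst q))"
    by (intro loc_eq.cong_mul loc_eq.refl loc_eq.mul_one_r)
  finally show ?thesis .
qed

text \<open>Only the product \<open>a * t\<close> has to lie in \<open>S\<close>. This matters for
  sums of fractions, where a common denominator \<open>a * s = b * t\<close> comes with a factor
  \<open>b\<close> that may lie outside \<open>S\<close>.\<close>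

lemma loc_eq_X_expand:
  assumes "t \<in> S" "a * t \<in> S"
  shows "loc_eq S (X t) (RMul (X (a * t)) (RConst a))"
proof -
  have "loc_eq S (X t) (RMul ROne (X t))" by (rule loc_eq.sym[OF loc_eq.mul_one_l])
  also have "loc_eq S \<dots> (RMul (RConst 1) (X t))"
    by (intro loc_eq.cong_mul loc_eq.refl loc_eq.sym[OF loc_eq.const_one])
  also have "loc_eq S \<dots> (RMul (X (a * t)) (RConst a))"
    using assms by (intro loc_eq_const_X) simp_all
  finally show ?thesis .
qed

lemma loc_eq_fraction_expand:
  assumes "s \<in> S" "a * s \<in> S"
  shows "loc_eq S (RMul (X s) (RConst r)) (RMul (X (a * s)) (RConst (a * r)))"
proof -
  have "loc_eq S (RMul (X s) (RConst r)) (RMul (RMul (X (a * s)) (RConst a)) (RConst r))"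
    by (intro loc_eq.cong_mul loc_eq_X_expand assms loc_eq.refl)
  also have "loc_eq S \<dots> (RMul (X (a * s)) (RMul (RConst a) (RConst r)))" by (rule loc_eq.mul_assoc)
  also have "loc_eq S \<dots> (RMul (X (a * s)) (RConst (a * r)))"
    by (intro loc_eq.cong_mul loc_eq.refl loc_eq.sym[OF loc_eq.const_mul])
  finally show ?thesis .
qed

lemma loc_eq_X_mult:
  assumes "s \<in> S" "u \<in> S" "u * s \<in> S"
  shows "loc_eq S (RMul (X s) (X u)) (X (u * s))"
proof -
  have "loc_eq S (RMul (X s) (X u)) (RMul (RMul (X (u * s)) (RConst u)) (X u))"
    by (intro loc_eq.cong_mul loc_eq_X_expand assms loc_eq.refl)
  also have "loc_eq S \<dots> (RMul (X (u * s)) (RMul (RConst u) (X u)))" by (rule loc_eq.mul_assoc)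
  also have "loc_eq S \<dots> (RMul (X (u * s)) ROne)"
    by (intro loc_eq.cong_mul loc_eq.refl loc_eq.inv_r assms)
  also have "loc_eq S \<dots> (X (u * s))" by (rule loc_eq.mul_one_r)
  finally show ?thesis .
qed

text \<open>Induction on terms: the Ore condition supplies a common denominator for a sum and
  interchanges the inner numerator and denominator of a product. The other cases are formal.\<close>

lemma left_denom_set_fraction:
  assumes S: "left_denom_set S" and "xvars e \<subseteq> S"
  shows "\<exists>s\<in>S. \<exists>r. loc_eq S e (RMul (X s) (RConst r))"
proof -
  have one: "1 \<in> S" and mult: "\<And>s t. s \<in> S \<Longrightarrow> t \<in> S \<Longrightarrow> s * t \<in> S"
    and ore: "\<And>r s. s \<in> S \<Longrightarrow> \<exists>t\<in>S. \<exists>r'. t * r = r' * s"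
    using S by (auto simp: left_denom_set_def mult_set_def)
  have X1: "loc_eq S (X 1) ROne"
  proof -
    have "loc_eq S (X 1) (RMul (X 1) ROne)" by (rule loc_eq.sym[OF loc_eq.mul_one_r])
    also have "loc_eq S \<dots> (RMul (X 1) (RConst 1))"
      by (intro loc_eq.cong_mul loc_eq.refl loc_eq.sym[OF loc_eq.const_one])
    also have "loc_eq S \<dots> ROne" using one by (rule loc_eq.inv_l)
    finally show ?thesis .
  qed
  have const: "loc_eq S (RConst r) (RMul (X 1) (RConst r))" for r
  proof -
    have "loc_eq S (RConst r) (RMul ROne (RConst r))" by (rule loc_eq.sym[OF loc_eq.mul_one_l])
    also have "loc_eq S \<dots> (RMul (X 1) (RConst r))"
      by (intro loc_eq.cong_mul loc_eq.refl loc_eq.sym[OF X1])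
    finally show ?thesis .
  qed
  show ?thesis
    using assms(2)
  proof (induction e)
    case (RConst r)
    show ?case using one const by blast
  next
    case (X s)
    have "loc_eq S (X s) (RMul (X s) ROne)" by (rule loc_eq.sym[OF loc_eq.mul_one_r])
    also have "loc_eq S \<dots> (RMul (X s) (RConst 1))"
      by (intro loc_eq.cong_mul loc_eq.refl loc_eq.sym[OF loc_eq.const_one])
    finally show ?case using X by auto
  next
    case RZero
    have "loc_eq S RZero (RMul (X 1) (RConst 0))"
      by (rule loc_eq.trans[OF loc_eq.sym[OF loc_eq.const_zero] const])
    then show ?case using one by blast
  next
    case ROne
    have "loc_eq S ROne (RMul (X 1) (RConst 1))"
      by (rule loc_eq.trans[OF loc_eq.sym[OF loc_eq.const_one] const])
    then show ?case using one by blast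
  next
    case (RAdd e f)
    then obtain s r t q where st: "s \<in> S" "t \<in> S"
      and e: "loc_eq S e (RMul (X s) (RConst r))" and f: "loc_eq S f (RMul (X t) (RConst q))"
      by auto
    obtain a b where ab: "a \<in> S" "a * s = b * t" using ore[OF st(2), of s] by blast
    let ?u = "a * s"
    have u: "?u \<in> S" using mult ab(1) st(1) by blast
    have "loc_eq S e (RMul (X ?u) (RConst (a * r)))"
      by (rule loc_eq.trans[OF e loc_eq_fraction_expand[OF st(1) u]])
    moreover have "loc_eq S f (RMul (X ?u) (RConst (b * q)))"
      using loc_eq.trans[OF f loc_eq_fraction_expand[OF st(2), of b q]] u ab(2) by simp
    ultimately have "loc_eq S (RAdd e f)
        (RAdd (RMul (X ?u) (RConst (a * r))) (RMul (X ?u) (RConst (b * q))))"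
      by (rule loc_eq.cong_add)
    also have "loc_eq S \<dots> (RMul (X ?u) (RAdd (RConst (a * r)) (RConst (b * q))))"
      by (rule loc_eq.sym[OF loc_eq.distrib_l])
    also have "loc_eq S \<dots> (RMul (X ?u) (RConst (a * r + b * q)))"
      by (intro loc_eq.cong_mul loc_eq.refl loc_eq.sym[OF loc_eq.const_add])
    finally show ?case using u by blast
  next
    case (RMul e f)
    then obtain s r t q where st: "s \<in> S" "t \<in> S"
      and e: "loc_eq S e (RMul (X s) (RConst r))" and f: "loc_eq S f (RMul (X t) (RConst q))"
      by auto
    obtain u p where u: "u \<in> S" "u * r = p * t" using ore[OF st(2), of r] by blast
    have us: "u * s \<in> S" using mult u(1) st(1) by blast
    have "loc_eq S (RMul e f) (RMul (RMul (X s) (RConst r)) (RMul (X t) (RConst q)))"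
      using e f by (rule loc_eq.cong_mul)
    also have "loc_eq S \<dots> (RMul (X s) (RMul (RConst r) (RMul (X t) (RConst q))))"
      by (rule loc_eq.mul_assoc)
    also have "loc_eq S \<dots> (RMul (X s) (RMul (RMul (RConst r) (X t)) (RConst q)))"
      by (intro loc_eq.cong_mul loc_eq.refl loc_eq.sym[OF loc_eq.mul_assoc])
    also have "loc_eq S \<dots> (RMul (X s) (RMul (RMul (X u) (RConst p)) (RConst q)))"
      by (intro loc_eq.cong_mul loc_eq.refl loc_eq_const_X st u)
    also have "loc_eq S \<dots> (RMul (X s) (RMul (X u) (RMul (RConst p) (RConst q))))"
      by (intro loc_eq.cong_mul loc_eq.refl loc_eq.mul_assoc)
    also have "loc_eq S \<dots> (RMul (RMul (X s) (X u)) (RMul (RConst p) (RConst q)))"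
      by (rule loc_eq.sym[OF loc_eq.mul_assoc])
    also have "loc_eq S \<dots> (RMul (X (u * s)) (RConst (p * q)))"
      by (intro loc_eq.cong_mul loc_eq_X_mult loc_eq.sym[OF loc_eq.const_mul] st u us)
    finally show ?case using us by blast
  next
    case (RNeg e)
    then obtain s r where s: "s \<in> S" and e: "loc_eq S e (RMul (X s) (RConst r))" by auto
    have "loc_eq S (RNeg e) (RNeg (RMul (X s) (RConst r)))" using e by (rule loc_eq.cong_neg)
    also have "loc_eq S \<dots> (RMul (X s) (RNeg (RConst r)))" by (rule loc_eq_neg_mult)
    also have "loc_eq S \<dots> (RMul (X s) (RConst (- r)))"
      by (intro loc_eq.cong_mul loc_eq.refl loc_eq.sym[OF loc_eq.const_neg])
    finally show ?case using s by blast
  qed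
qed

text \<open>A term acts from the right as a partial left-linear map on \<open>U\<close>, with \<open>x\<^sub>s\<close> inverting right
  multiplication by \<open>s\<close>; indeterminates outside \<open>S\<close> act as zero. This replaces the construction of
  the ring of fractions: it suffices to see that the class of \<open>1\<close> differs from that of \<open>0\<close>.\<close>
fun partial_map :: "'a::ring_1 set \<Rightarrow> 'a set \<Rightarrow> 'a rterm \<Rightarrow> 'a \<Rightarrow> 'a \<Rightarrow> bool" where
  "partial_map U S (RConst r) x y \<longleftrightarrow> x \<in> U \<and> y = x * r"
| "partial_map U S (X s) x y \<longleftrightarrow> (if s \<in> S then y \<in> U \<and> x = y * s else x \<in> U \<and> y = 0)"
| "partial_map U S RZero x y \<longleftrightarrow> x \<in> U \<and> y = 0"
| "partial_map U S ROne x y \<longleftrightarrow> x \<in> U \<and> y = x"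
| "partial_map U S (RAdd a b) x y \<longleftrightarrow> (\<exists>u v. partial_map U S a x u \<and> partial_map U S b x v \<and> y = u + v)"
| "partial_map U S (RMul a b) x y \<longleftrightarrow> (\<exists>u. partial_map U S a x u \<and> partial_map U S b u y)"
| "partial_map U S (RNeg a) x y \<longleftrightarrow> (\<exists>u. partial_map U S a x u \<and> y = - u)"

context
  fixes U S :: "'a::ring_1 set"
  assumes U: "two_sided_ideal U"
begin

text \<open>Together with the next three lemmas: the graph of a term is a left submodule of
  \<open>U \<times> U\<close>.\<close>

lemma partial_map_in: "partial_map U S e x y \<Longrightarrow> x \<in> U \<and> y \<in> U"
proof (induction e arbitrary: x y)
  case (X s)
  then show ?case using U by (auto simp: two_sided_ideal_def left_ideal_def split: if_splits)
next
  case (RAdd a b)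
  from RAdd.prems obtain u v where "partial_map U S a x u" "partial_map U S b x v" "y = u + v" by auto
  then show ?case using RAdd.IH U by (auto simp: two_sided_ideal_def left_ideal_def)
next
  case (RMul a b)
  from RMul.prems obtain u where "partial_map U S a x u" "partial_map U S b u y" by auto
  then show ?case using RMul.IH by blast
next
  case (RNeg a)
  from RNeg.prems obtain u where "partial_map U S a x u" "y = - u" by auto
  then show ?case using RNeg.IH U by (auto simp: two_sided_ideal_def left_ideal_def)
qed (use U in \<open>auto simp: two_sided_ideal_def left_ideal_def\<close>)

lemma partial_map_mult: "partial_map U S e x y \<Longrightarrow> partial_map U S e (r * x) (r * y)"
proof (induction e arbitrary: x y)
  case (RAdd a b)
  then obtain u v where "partial_map U S a x u" "partial_map U S b x v" "y = u + v" by auto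
  moreover from this have "r * y = r * u + r * v" by (simp add: distrib_left)
  ultimately show ?case using RAdd.IH unfolding partial_map.simps by blast
next
  case (RMul a b)
  then show ?case unfolding partial_map.simps by blast
next
  case (RNeg a)
  then show ?case unfolding partial_map.simps by (metis mult_minus_right)
qed (use U in \<open>auto simp: two_sided_ideal_def left_ideal_def mult.assoc split: if_splits\<close>)

lemma partial_map_add:
  "partial_map U S e x y \<Longrightarrow> partial_map U S e x' y' \<Longrightarrow> partial_map U S e (x + x') (y + y')"
proof (induction e arbitrary: x y x' y')
  case (RAdd a b)
  from RAdd.prems obtain u v u' v' where "partial_map U S a x u" "partial_map U S b x v" "y = u + v"
    "partial_map U S a x' u'" "partial_map U S b x' v'" "y' = u' + v'" by auto
  moreover from this have "y + y' = (u + u') + (v + v')" by simp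
  ultimately show ?case using RAdd.IH unfolding partial_map.simps by blast
next
  case (RMul a b)
  then show ?case unfolding partial_map.simps by blast
next
  case (RNeg a)
  from RNeg.prems obtain u u' where "partial_map U S a x u" "y = - u" "partial_map U S a x' u'" "y' = - u'"
    by auto
  moreover from this have "y + y' = - (u + u')" by simp
  ultimately show ?case using RNeg.IH unfolding partial_map.simps by blast
qed (use U in \<open>auto simp: two_sided_ideal_def left_ideal_def distrib_right split: if_splits\<close>)

lemma partial_map_zero: "partial_map U S e 0 0"
proof (induction e)
  case (RAdd a b)
  then show ?case unfolding partial_map.simps by (metis add_0)
next
  case (RMul a b)
  then show ?case unfolding partial_map.simps by blast
next
  case (RNeg a)
  then show ?case unfolding partial_map.simps by (metis minus_zero)
qed (use U in \<open>auto simp: two_sided_ideal_def left_ideal_def\<close>)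

context
  assumes canc: "\<And>s x. s \<in> S \<Longrightarrow> x \<in> U \<Longrightarrow> x * s = 0 \<Longrightarrow> x = 0"
begin

lemma partial_map_unique: "partial_map U S e x y \<Longrightarrow> partial_map U S e x y' \<Longrightarrow> y = y'"
proof (induction e arbitrary: x y y')
  case (X s)
  show ?case
  proof (cases "s \<in> S")
    case True
    then have "y \<in> U" "y' \<in> U" "(y - y') * s = 0" using X by (auto simp: left_diff_distrib)
    moreover from this have "y - y' \<in> U"
      using U left_ideal_diff unfolding two_sided_ideal_def by blast
    ultimately show ?thesis using canc[OF True, of "y - y'"] by simp
  qed (use X in simp)
next
  case (RAdd a b)
  then show ?case unfolding partial_map.simps by blast
next
  case (RMul a b)
  then show ?case unfolding partial_map.simps by blast
next
  case (RNeg a)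
  then show ?case unfolding partial_map.simps by blast
qed auto

text \<open>Essential domains survive the term constructors: for a sum, scale into one domain and
  then into the other; for a product, scale until the first value enters the second domain. Uniform
  dimension enters at the indeterminates of \<open>S\<close>.\<close>

lemma partial_map_essential:
  assumes dim: "finite_left_uniform_dim TYPE('a)"
  shows "essential_in U {x. \<exists>y. partial_map U S e x y}"
proof (induction e)
  case (X s)
  show ?case
  proof (cases "s \<in> S")
    case True
    then have "{x. \<exists>y. partial_map U S (X s) x y} = (\<lambda>x. x * s) ` U" by auto
    moreover have "essential_in U ((\<lambda>x. x * s) ` U)"
      using U canc[OF True] by (intro essential_in_right_multiples[OF dim]) (auto simp: two_sided_ideal_def)
    ultimately show ?thesis by simp
  next
    \<comment> \<open>Intermediate terms of a \<open>loc_eq\<close> derivation may contain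
      indeterminates outside \<open>S\<close>; the total default keeps their domains
      essential.\<close>
    case False
    then show ?thesis by (auto simp: essential_in_def intro: exI[of _ 1])
  qed
next
  case (RAdd a b)
  show ?case
    unfolding essential_in_def
  proof (intro ballI impI)
    fix u assume u: "u \<in> U" "u \<noteq> 0"
    obtain r y where r: "partial_map U S a (r * u) y" "r * u \<noteq> 0"
      using essential_inE[OF RAdd.IH(1) u] by blast
    then obtain q z where q: "partial_map U S b (q * (r * u)) z" "q * (r * u) \<noteq> 0"
      using essential_inE[OF RAdd.IH(2)] partial_map_in[OF r(1)] by blast
    have "partial_map U S (RAdd a b) ((q * r) * u) (q * y + z)"
      using partial_map_mult[OF r(1), of q] q(1) by (auto simp: mult.assoc)
    then show "\<exists>r. r * u \<in> {x. \<exists>y. partial_map U S (RAdd a b) x y} \<and> r * u \<noteq> 0"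
      using q(2) by (intro exI[of _ "q * r"]) (auto simp: mult.assoc)
  qed
next
  case (RMul a b)
  show ?case
    unfolding essential_in_def
  proof (intro ballI impI)
    fix u assume u: "u \<in> U" "u \<noteq> 0"
    obtain r y where r: "partial_map U S a (r * u) y" "r * u \<noteq> 0"
      using essential_inE[OF RMul.IH(1) u] by blast
    show "\<exists>r. r * u \<in> {x. \<exists>y. partial_map U S (RMul a b) x y} \<and> r * u \<noteq> 0"
    \<comment> \<open>Essentiality speaks about nonzero values only. A zero value needs no scaling,
      as \<open>0\<close> lies in every domain; a nonzero scaled value \<open>q * y\<close> keeps
      the argument nonzero by single-valuedness.\<close>
    proof (cases "y = 0")
      case True
      then show ?thesis using r partial_map_zero by auto
    next
      case False
      then obtain q z where q: "partial_map U S b (q * y) z" "q * y \<noteq> 0"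
        using essential_inE[OF RMul.IH(2)] partial_map_in[OF r(1)] by blast
      have a: "partial_map U S a ((q * r) * u) (q * y)"
        using partial_map_mult[OF r(1), of q] by (simp add: mult.assoc)
      then have "(q * r) * u \<noteq> 0" using q(2) partial_map_unique partial_map_zero by metis
      then show ?thesis using a q(1) by (intro exI[of _ "q * r"]) auto
    qed
  qed
next
  case (RNeg a)
  then show ?case by simp
qed (auto simp: essential_in_def intro: exI[of _ 1])

end

end

section \<open>Semiprime left Goldie rings\<close>

text \<open>The annihilator ideals. Two left annihilators replace the usual left-right pair because
  over a semiprime ring the left and right annihilators of a two-sided ideal coincide.\<close>

definition closed_ideal :: "'a::ring_1 set \<Rightarrow> bool" where
  "closed_ideal I \<longleftrightarrow> two_sided_ideal I \<and> left_ann (left_ann I) = I"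

definition minimal_closed :: "'a::ring_1 set \<Rightarrow> bool" where
  "minimal_closed U \<longleftrightarrow> closed_ideal U \<and> U \<noteq> {0} \<and>
     (\<forall>V. closed_ideal V \<longrightarrow> V \<subseteq> U \<longrightarrow> V = {0} \<or> V = U)"

locale semiprime_left_Goldie =
  fixes R :: "'a::ring_1 itself"
  assumes semiprime: "semiprime_ring TYPE('a)"
    and goldie: "left_Goldie TYPE('a)"
begin

section \<open>Singular elements and regular elements\<close>

lemma acc: "acc_left_annihilators TYPE('a)" and dim: "finite_left_uniform_dim TYPE('a)"
  using goldie by (auto simp: left_Goldie_def)

text \<open>An ideal of square zero containing \<open>a\<close>, described without the sums needed for \<open>RaR\<close>: intersect
  \<open>I = l.ann(Ra)\<close> with its right annihilator.\<close>
lemma semiprimeD: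
  fixes a :: 'a
  assumes "\<And>r. a * r * a = 0"
  shows "a = 0"
proof -
  define I where "I = {y. \<forall>r. y * r * a = 0}"
  define J where "J = {x \<in> I. \<forall>y\<in>I. y * x = 0}"
  have I: "y * r \<in> I" "r * y \<in> I" if "y \<in> I" for y r
  proof -
    have y: "y * q * a = 0" for q using that by (simp add: I_def)
    show "y * r \<in> I" using y[of "r * q" for q] by (simp add: I_def mult.assoc)
    show "r * y \<in> I" using y by (simp add: I_def mult.assoc)
  qed
  have J: "two_sided_ideal J"
    unfolding two_sided_ideal_def left_ideal_def
  proof (intro conjI ballI allI impI)
    show "0 \<in> J" by (simp add: J_def I_def)
  next
    fix x y assume "x \<in> J" "y \<in> J"
    then show "x + y \<in> J" by (simp add: J_def I_def distrib_left distrib_right)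
  next
    fix x assume "x \<in> J"
    then show "- x \<in> J" by (simp add: J_def I_def)
  next
    fix r x assume "x \<in> J"
    moreover have "y * (r * x) = 0" if "y \<in> I" for y
      using I(1)[OF that, of r] \<open>x \<in> J\<close> by (simp add: J_def mult.assoc[symmetric])
    ultimately show "r * x \<in> J" using I(2) by (simp add: J_def)
  next
    fix r x assume "x \<in> J"
    then show "x * r \<in> J" using I(1) by (simp add: J_def mult.assoc[symmetric])
  qed
  have "nilpotent_ideal J"
    unfolding nilpotent_ideal_def
  proof (intro exI[of _ 2] conjI allI impI)
    fix xs :: "'a list" assume "length xs = 2" "set xs \<subseteq> J"
    then obtain x y where "xs = [x, y]" "x \<in> J" "y \<in> J"
      by (auto simp: numeral_2_eq_2 length_Suc_conv)
    then show "prod_list xs = 0" by (auto simp: J_def)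
  qed simp
  then have "J = {0}" using J semiprime by (auto simp: semiprime_ring_def)
  \<comment> \<open>For \<open>y \<in> I\<close> the choice \<open>r = 1\<close> gives
    \<open>y * a = 0\<close>.\<close>
  moreover have "a \<in> J" using assms by (auto simp: J_def I_def) (metis mult.right_neutral)
  ultimately show ?thesis by blast
qed

text \<open>Among nonzero elements with essential left annihilator take \<open>a\<close> with
  maximal annihilator. If \<open>a * r * a \<noteq> 0\<close>, maximality gives it the same
  annihilator as \<open>a\<close>; a nonzero \<open>q * (a * r)\<close> in the essential
  \<open>left_ann {a}\<close> then yields \<open>q * a = 0\<close>, a contradiction. So
  \<open>aRa = 0\<close>.\<close>

lemma singular_zero:
  fixes x :: 'a
  assumes "essential_in UNIV (left_ann {x})"
  shows "x = 0"
proof (rule ccontr)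
  assume "x \<noteq> 0"
  let ?Z = "{x::'a. essential_in UNIV (left_ann {x}) \<and> x \<noteq> 0}"
  obtain M where M: "M \<in> (\<lambda>x. left_ann {x}) ` ?Z"
    "\<And>A. A \<in> (\<lambda>x. left_ann {x}) ` ?Z \<Longrightarrow> M \<subseteq> A \<Longrightarrow> A = M"
    using acc_left_annihilators_maximal[OF acc, of "(\<lambda>x. left_ann {x}) ` ?Z"] \<open>x \<noteq> 0\<close> assms by blast
  then obtain a where a: "essential_in UNIV (left_ann {a})" "a \<noteq> 0" and Ma: "M = left_ann {a}"
    by auto
  have "a * r * a = 0" for r
  proof (rule ccontr)
    assume nz: "a * r * a \<noteq> 0"
    have sub: "M \<subseteq> left_ann {a * r * a}"
      by (auto simp: Ma left_ann_def mult.assoc[symmetric])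
    have "essential_in UNIV (left_ann {a * r * a})"
      using a(1) sub unfolding Ma essential_in_def by blast
    then have eq: "left_ann {a * r * a} = left_ann {a}"
      using M(2) sub nz Ma by blast
    show False
    proof (cases "a * r = 0")
      case True
      then show False using nz by simp
    next
      case False
      then obtain q where q: "q * (a * r) \<in> left_ann {a}" "q * (a * r) \<noteq> 0"
        using essential_inE[OF a(1)] by blast
      then have "q \<in> left_ann {a * r * a}" by (simp add: left_ann_def mult.assoc)
      then have "q * a = 0" unfolding eq by (simp add: left_ann_def)
      then show False using q(2) by (simp add: mult.assoc[symmetric])
    qed
  qed
  then show False using semiprimeD a(2) by blast
qed

text \<open>A nonzero \<open>a \<in> L\<close> with maximal left annihilator has the same
  annihilator as any nonzero \<open>a * r * a\<close>, and \<open>b = r * a\<close> inherits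
  cancellability from this. The last property means that \<open>Rb\<close> meets
  \<open>left_ann {b}\<close> trivially.\<close>

lemma ex_square_cancellable:
  fixes L :: "'a set"
  assumes "left_ideal L" "L \<noteq> {0}"
  obtains b where "b \<in> L" "b \<noteq> 0" "\<And>y. y * b * b = 0 \<Longrightarrow> y * b = 0"
proof -
  let ?Z = "L - {0}"
  have "?Z \<noteq> {}" using assms left_idealD(1) by blast
  then obtain M where M: "M \<in> (\<lambda>x. left_ann {x}) ` ?Z"
    "\<And>A. A \<in> (\<lambda>x. left_ann {x}) ` ?Z \<Longrightarrow> M \<subseteq> A \<Longrightarrow> A = M"
    using acc_left_annihilators_maximal[OF acc, of "(\<lambda>x. left_ann {x}) ` ?Z"] by blast
  then obtain a where a: "a \<in> L" "a \<noteq> 0" and Ma: "M = left_ann {a}" by auto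
  obtain r where r: "a * r * a \<noteq> 0" using semiprimeD a(2) by blast
  have "M \<subseteq> left_ann {a * r * a}" by (auto simp: Ma left_ann_def mult.assoc[symmetric])
  moreover have "a * r * a \<in> ?Z" using r a left_idealD(4)[OF assms(1)] by blast
  ultimately have eq: "left_ann {a * r * a} = left_ann {a}" using M(2) Ma by blast
  show thesis
  proof
    show "r * a \<in> L" using a left_idealD(4)[OF assms(1)] by blast
    show "r * a \<noteq> 0" using r by (auto simp: mult.assoc)
    fix y assume "y * (r * a) * (r * a) = 0"
    then have "y * r \<in> left_ann {a * r * a}" by (simp add: left_ann_def mult.assoc)
    then show "y * (r * a) = 0" unfolding eq by (simp add: left_ann_def mult.assoc)
  qed
qed

text \<open>Uniform dimension makes \<open>Rc\<close> essential, and \<open>c * x = 0\<close> puts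
  \<open>Rc\<close> inside the left annihilator of \<open>x\<close>, so \<open>x\<close> is singular
  and vanishes.\<close>

lemma left_cancellable_regular:
  fixes c :: 'a
  assumes "\<And>x. x * c = 0 \<Longrightarrow> x = 0"
  shows "c \<in> regular_elems"
proof -
  have ess: "essential_in UNIV (range (\<lambda>x. x * c))"
    using essential_in_right_multiples[OF dim left_ideal_UNIV] assms by blast
  have "x = 0" if "c * x = 0" for x
  proof (rule singular_zero)
    have "range (\<lambda>x. x * c) \<subseteq> left_ann {x}" using that by (auto simp: left_ann_def mult.assoc)
    then show "essential_in UNIV (left_ann {x})" using ess unfolding essential_in_def by blast
  qed
  then show ?thesis using assms unfolding regular_elems_def by blast
qed

text \<open>Adding square-cancellable elements \<open>b\<^sub>n \<in> L \<inter> l.ann(c\<^sub>n)\<close> makes \<open>l.ann(c\<^sub>n)\<close> shrink, \<open>Rb\<^sub>n\<close> being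
  independent of what remains; finite uniform dimension stops this at \<open>l.ann(c\<^sub>n) = 0\<close>.\<close>
lemma essential_contains_regular:
  fixes L :: "'a set"
  assumes L: "left_ideal L" and ess: "essential_in UNIV L"
  obtains c where "c \<in> L" "c \<in> regular_elems"
proof -
  have "\<exists>c\<in>L. left_ann {c} = {0}"
  proof (rule ccontr)
    assume neg: "\<not> (\<exists>c\<in>L. left_ann {c} = {0})"
    define Q where "Q (c :: 'a) \<longleftrightarrow> c \<in> L \<and> (\<forall>x. x * c * c = 0 \<longrightarrow> x * c = 0)" for c
    define step where "step (c :: 'a) c' \<longleftrightarrow> (\<exists>b. c' = c + b \<and> b * c = 0 \<and> b \<noteq> 0 \<and>
      (\<forall>x. x * b * b = 0 \<longrightarrow> x * b = 0))" for c c'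
    have ex: "\<exists>c'. Q c' \<and> step c c'" if Qc: "Q c" for c
    proof -
      have "left_ann {c} \<noteq> {0}" using neg Qc by (auto simp: Q_def)
      then obtain u where u: "u \<in> left_ann {c}" "u \<noteq> 0"
        using left_idealD(1)[OF left_ideal_left_ann] by blast
      obtain r where "r * u \<in> L" "r * u \<noteq> 0" using essential_inE[OF ess _ u(2)] by blast
      then have "r * u \<in> L \<inter> left_ann {c}" using left_idealD(4)[OF left_ideal_left_ann u(1)] by blast
      with \<open>r * u \<noteq> 0\<close> have "L \<inter> left_ann {c} \<noteq> {0}" by blast
      then obtain b where b: "b \<in> L \<inter> left_ann {c}" "b \<noteq> 0" "\<And>y. y * b * b = 0 \<Longrightarrow> y * b = 0"
        by (rule ex_square_cancellable[OF left_ideal_Int[OF L left_ideal_left_ann]]) (rule that)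
      then have bL: "b \<in> L" and bc0: "b * c = 0" by (auto simp: left_ann_def)
      have "x * (c + b) = 0" if x: "x * (c + b) * (c + b) = 0" for x
      proof -
        have bc: "z * b * c = 0" for z using bc0 by (simp add: mult.assoc)
        \<comment> \<open>Since \<open>b * c = 0\<close>, right multiplication by \<open>c\<close>
          leaves only \<open>x * c^3\<close>; the invariant \<open>Q c\<close> then separates the
          \<open>c\<close> part from the \<open>b\<close> part.\<close>
        have "x * (c + b) * (c + b) * c = 0" using x by simp
        then have "x * c * c * c = 0" by (simp add: distrib_left distrib_right bc)
        then have xc: "x * c = 0" using Qc by (auto simp: Q_def)
        then have "x * b * b = 0" using x by (simp add: distrib_left distrib_right bc)
        then show ?thesis using b(3) xc by (simp add: distrib_left)
      qed
      then have "Q (c + b)" using Qc bL left_idealD(2)[OF L] by (auto simp: Q_def)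
      then show ?thesis using b bc0 unfolding step_def by blast
    qed
    have "Q 0" using left_idealD(1)[OF L] by (simp add: Q_def)
    then obtain c where c: "\<And>n::nat. Q (c n)" "\<And>n. step (c n) (c (Suc n))"
      using dependent_nat_choice[of "\<lambda>_. Q" "\<lambda>_. step"] ex by blast
    then obtain b where b: "\<And>n. c (Suc n) = c n + b n" "\<And>n. b n * c n = 0" "\<And>n. b n \<noteq> 0"
      "\<And>n x. x * b n * b n = 0 \<Longrightarrow> x * b n = 0"
      unfolding step_def by metis
    have l: "x * c n = 0 \<and> x * b n = 0" if "x * c (Suc n) = 0" for x n
    proof -
      have "x * c (Suc n) * c n = 0" using that by simp
      then have "x * c n * c n = 0" using b(2)[of n] by (simp add: b(1) distrib_left distrib_right mult.assoc)
      then have "x * c n = 0" using c(1) by (auto simp: Q_def)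
      then show ?thesis using that by (simp add: b(1) distrib_left)
    qed
    show False
    proof (rule uniform_dim_chain[OF dim, of "\<lambda>n. left_ann {c n}" "\<lambda>n. range (\<lambda>r. r * b n)"])
      fix n
      show "left_ideal (left_ann {c n})" by (rule left_ideal_left_ann)
      show "left_ann {c (Suc n)} \<subseteq> left_ann {c n}" using l by (auto simp: left_ann_def)
      show "left_ideal (range (\<lambda>r. r * b n))" by (rule left_ideal_principal)
      have "1 * b n \<noteq> 0" using b(3) by simp
      then show "range (\<lambda>r. r * b n) \<noteq> {0}" by blast
      show "range (\<lambda>r. r * b n) \<subseteq> left_ann {c n}" using b(2) by (auto simp: left_ann_def mult.assoc)
      show "range (\<lambda>r. r * b n) \<inter> left_ann {c (Suc n)} \<subseteq> {0}"
        using l b(4) by (fastforce simp: left_ann_def)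
    qed
  qed
  then obtain c where "c \<in> L" "left_ann {c} = {0}" by blast
  moreover then have "c \<in> regular_elems" 
    by (intro left_cancellable_regular) (auto simp: left_ann_def)
  ultimately show thesis using that by blast
qed

section \<open>Annihilator ideals\<close>

lemma left_ann_iff_right:
  fixes I :: "'a set"
  assumes I: "two_sided_ideal I"
  shows "x \<in> left_ann I \<longleftrightarrow> (\<forall>i\<in>I. i * x = 0)"
proof
  assume x: "x \<in> left_ann I"
  show "\<forall>i\<in>I. i * x = 0"
  proof
    fix i assume "i \<in> I"
    \<comment> \<open>The product contains \<open>x * (r * i)\<close>, which vanishes as
      \<open>r * i \<in> I\<close>; semiprimeness does the rest. The converse has the same
      shape.\<close>
    have "i * x * r * (i * x) = 0" for r
    proof -
      have "r * i \<in> I" using I \<open>i \<in> I\<close> by (auto simp: two_sided_ideal_def left_ideal_def)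
      then have "x * (r * i) = 0" using x by (auto simp: left_ann_def)
      then have "i * (x * (r * i)) * x = 0" by simp
      then show ?thesis by (simp add: mult.assoc)
    qed
    then show "i * x = 0" by (rule semiprimeD)
  qed
next
  assume x: "\<forall>i\<in>I. i * x = 0"
  have "x * i = 0" if "i \<in> I" for i
  proof (rule semiprimeD)
    fix r
    have "i * r \<in> I" using I that by (auto simp: two_sided_ideal_def)
    then have "x * (i * r * x) * i = 0" using x by simp
    then show "x * i * r * (x * i) = 0" by (simp add: mult.assoc)
  qed
  then show "x \<in> left_ann I" by (auto simp: left_ann_def)
qed

text \<open>\<open>Y\<close> may be any subset: for the two-sided ideal \<open>I\<close>,
  semiprimeness turns \<open>I Y = 0\<close> into \<open>Y I = 0\<close>, so
  \<open>Y \<subseteq> left_ann I\<close>.\<close>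

lemma closed_idealI:
  fixes I :: "'a set"
  assumes I: "two_sided_ideal I" and Y: "I = left_ann Y"
  shows "closed_ideal I"
proof -
  have "left_ann (left_ann I) \<subseteq> I"
  proof -
    have "Y \<subseteq> left_ann I" using left_ann_iff_right[OF I] Y by (auto simp: left_ann_def)
    then show ?thesis using Y by (auto simp: left_ann_def)
  qed
  moreover have "I \<subseteq> left_ann (left_ann I)"
    using left_ann_iff_right[OF I] by (auto simp: left_ann_def[of "left_ann I"])
  ultimately show ?thesis using I by (auto simp: closed_ideal_def)
qed

lemma closed_ideal_left_ann: "two_sided_ideal (I :: 'a set) \<Longrightarrow> closed_ideal (left_ann I)"
  using closed_idealI two_sided_ideal_left_ann by blast

lemma closed_ideal_Int:
  fixes I J :: "'a set"
  assumes "closed_ideal I" "closed_ideal J"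
  shows "closed_ideal (I \<inter> J)"
proof (rule closed_idealI)
  show "two_sided_ideal (I \<inter> J)" using assms two_sided_ideal_Int by (auto simp: closed_ideal_def)
  have "left_ann (left_ann I \<union> left_ann J) = left_ann (left_ann I) \<inter> left_ann (left_ann J)"
    unfolding left_ann_def[of "left_ann I \<union> left_ann J"] left_ann_def[of "left_ann I"]
      left_ann_def[of "left_ann J"] by blast
  then show "I \<inter> J = left_ann (left_ann I \<union> left_ann J)" using assms by (simp add: closed_ideal_def)
qed

lemma Int_left_ann:
  fixes I :: "'a set"
  assumes I: "two_sided_ideal I" and x: "x \<in> I" "x \<in> left_ann I"
  shows "x = 0"
proof (rule semiprimeD)
  fix r
  have "r * x \<in> I" using I x by (auto simp: two_sided_ideal_def left_ideal_def)
  then show "x * r * x = 0" using x(2) by (auto simp: left_ann_def mult.assoc)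
qed

text \<open>On closed ideals \<open>left_ann\<close> is injective and reverses inclusion, so the
  ascending condition on left annihilators becomes a minimal condition.\<close>

lemma closed_ideal_minimal:
  fixes \<I> :: "'a set set"
  assumes "\<I> \<noteq> {}" "\<And>I. I \<in> \<I> \<Longrightarrow> closed_ideal I"
  obtains M where "M \<in> \<I>" "\<And>I. I \<in> \<I> \<Longrightarrow> I \<subseteq> M \<Longrightarrow> I = M"
proof -
  obtain N where N: "N \<in> left_ann ` \<I>" "\<And>A. A \<in> left_ann ` \<I> \<Longrightarrow> N \<subseteq> A \<Longrightarrow> A = N"
    using acc_left_annihilators_maximal[OF acc, of "left_ann ` \<I>"] assms(1) by blast
  then obtain M where M: "M \<in> \<I>" "N = left_ann M" by blast
  have "I = M" if "I \<in> \<I>" "I \<subseteq> M" for I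
  proof -
    have "N \<subseteq> left_ann I" using that M by (auto simp: left_ann_def)
    then have "left_ann I = left_ann M" using N(2) that M by blast
    then show ?thesis using assms(2) that M by (metis closed_ideal_def)
  qed
  then show thesis using that M by blast
qed

lemma ex_minimal_closed:
  fixes I :: "'a set"
  assumes "closed_ideal I" "I \<noteq> {0}"
  obtains U where "minimal_closed U" "U \<subseteq> I"
proof -
  let ?F = "{J. closed_ideal J \<and> J \<noteq> {0} \<and> J \<subseteq> I}"
  have "?F \<noteq> {}" using assms by blast
  then obtain U where U: "U \<in> ?F" "\<And>J. J \<in> ?F \<Longrightarrow> J \<subseteq> U \<Longrightarrow> J = U"
    using closed_ideal_minimal[of ?F] by blast
  then have "minimal_closed U" unfolding minimal_closed_def by blast
  then show thesis using that U by blast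
qed

section \<open>Minimal annihilator ideals and minimal primes\<close>

lemma minimal_closedD:
  assumes "minimal_closed (U :: 'a set)"
  shows "two_sided_ideal U" "left_ideal U" "closed_ideal U" "U \<noteq> {0}" "\<exists>u\<in>U. u \<noteq> 0"
  "x \<in> U \<Longrightarrow> x * r \<in> U" "x \<in> U \<Longrightarrow> r * x \<in> U"
  using assms by (auto simp: minimal_closed_def closed_ideal_def two_sided_ideal_def left_ideal_def)

text \<open>If \<open>AB\<close> annihilates \<open>U\<close>, the closed ideal
  \<open>U \<inter> left_ann A\<close> contains \<open>BU\<close>. By minimality it is
  \<open>{0}\<close>, whence \<open>BU = 0\<close>, or \<open>U\<close>, whence
  \<open>AU = 0\<close>.\<close>

lemma prime_left_ann:
  fixes U :: "'a set"
  assumes U: "minimal_closed U"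
  shows "prime_ideal (left_ann U)"
  unfolding prime_ideal_def
proof (intro conjI allI impI)
  note U' = minimal_closedD[OF U]
  show "two_sided_ideal (left_ann U)" using two_sided_ideal_left_ann U'(1) by blast
  show "left_ann U \<noteq> UNIV"
  proof
    assume "left_ann U = UNIV"
    then have "1 \<in> left_ann U" by simp
    then show False using U'(5) by (auto simp: left_ann_def)
  qed
  fix A B :: "'a set"
  assume A: "two_sided_ideal A" and B: "two_sided_ideal B" and AB: "\<forall>a\<in>A. \<forall>b\<in>B. a * b \<in> left_ann U"
  have "closed_ideal (U \<inter> left_ann A)"
    using closed_ideal_Int closed_ideal_left_ann[OF A] U'(3) by blast
  then consider "U \<inter> left_ann A = {0}" | "U \<inter> left_ann A = U" 
    using U unfolding minimal_closed_def by blast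
  then show "A \<subseteq> left_ann U \<or> B \<subseteq> left_ann U"
  proof cases
    case 1
    have "b * u = 0" if "b \<in> B" "u \<in> U" for b u
    proof -
      have "\<forall>a\<in>A. a * (b * u) = 0" using AB that by (auto simp: left_ann_def mult.assoc)
      then have "b * u \<in> left_ann A" using left_ann_iff_right[OF A] by blast
      then show ?thesis using 1 U'(7) that by blast
    qed
    then show ?thesis by (auto simp: left_ann_def)
  next
    case 2
    then have "\<forall>u\<in>U. \<forall>a\<in>A. a * u = 0" using left_ann_iff_right[OF A] by blast
    then show ?thesis by (auto simp: left_ann_def)
  qed
qed

text \<open>\<open>U\<close> times its annihilator is zero, so a prime inside
  \<open>left_ann U\<close> contains one of the two, and it cannot contain \<open>U\<close>; this
  gives minimality of \<open>left_ann U\<close>.\<close>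

lemma min_primes_eq: "(min_primes :: 'a set set) = left_ann ` {U. minimal_closed U}"
proof (intro equalityI subsetI)
  fix P :: "'a set" assume "P \<in> left_ann ` {U. minimal_closed U}"
  then obtain U where U: "minimal_closed U" and P: "P = left_ann U" by blast
  note U' = minimal_closedD[OF U]
  have "Q = P" if Q: "prime_ideal Q" "Q \<subseteq> P" for Q
  proof -
    have "two_sided_ideal P" using two_sided_ideal_left_ann U'(1) P by blast
    moreover have "\<forall>u\<in>U. \<forall>p\<in>P. u * p \<in> Q"
      using left_ann_iff_right[OF U'(1)] P Q(1) by (simp add: prime_ideal_def two_sided_ideal_def left_ideal_def)
    ultimately have "U \<subseteq> Q \<or> P \<subseteq> Q" using Q(1) U'(1) by (auto simp: prime_ideal_def)
    moreover have "\<not> U \<subseteq> Q" using Q(2) P U'(5) Int_left_ann[OF U'(1)] by blast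
    ultimately show ?thesis using Q(2) by blast
  qed
  then show "P \<in> min_primes" using prime_left_ann[OF U] P unfolding min_primes_def by blast
next
  fix P :: "'a set" assume "P \<in> min_primes"
  then have P: "prime_ideal P" "\<And>Q. prime_ideal Q \<Longrightarrow> Q \<subseteq> P \<Longrightarrow> Q = P"
    by (auto simp: min_primes_def)
  \<comment> \<open>A closed ideal minimal outside \<open>P\<close> takes the place of a finite
    product of annihilators: cutting it with \<open>left_ann U\<close> makes it strictly smaller and
    so pushes it into \<open>P\<close>.\<close>
  let ?F = "{I. closed_ideal I \<and> \<not> I \<subseteq> P}"
  have "closed_ideal (UNIV :: 'a set)"
    using closed_idealI[of UNIV "{}"] two_sided_ideal_UNIV by (auto simp: left_ann_def)
  then have "?F \<noteq> {}" using P(1) by (auto simp: prime_ideal_def)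
  then obtain I where I: "I \<in> ?F" "\<And>J. J \<in> ?F \<Longrightarrow> J \<subseteq> I \<Longrightarrow> J = I"
    using closed_ideal_minimal[of ?F] by blast
  have "0 \<in> P" using P(1) by (auto simp: prime_ideal_def two_sided_ideal_def left_ideal_def)
  then have "I \<noteq> {0}" using I(1) by blast
  then obtain U where U: "minimal_closed U" "U \<subseteq> I" using ex_minimal_closed I(1) by blast
  note U' = minimal_closedD[OF U(1)]
  have annU: "two_sided_ideal (left_ann U)" and tI: "two_sided_ideal I"
    using two_sided_ideal_left_ann U'(1) I(1) by (auto simp: closed_ideal_def)
  have "I \<inter> left_ann U \<noteq> I" using Int_left_ann[OF U'(1)] U(2) U'(5) by blast
  then have sub: "I \<inter> left_ann U \<subseteq> P"
    using I(2)[of "I \<inter> left_ann U"] closed_ideal_Int closed_ideal_left_ann[OF U'(1)] I(1) by blast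
  have "\<forall>a\<in>I. \<forall>b\<in>left_ann U. a * b \<in> I \<inter> left_ann U"
    using tI annU by (auto simp: two_sided_ideal_def left_ideal_def)
  then have "I \<subseteq> P \<or> left_ann U \<subseteq> P"
    using P(1) tI annU sub unfolding prime_ideal_def by blast
  then have "left_ann U \<subseteq> P" using I(1) by blast
  then have "P = left_ann U" using P(2) prime_left_ann[OF U(1)] by blast
  then show "P \<in> left_ann ` {U. minimal_closed U}" using U by blast
qed

section \<open>The sets C(P) and their Ore condition\<close>

lemma C_mod_left_ann:
  fixes U :: "'a set"
  assumes U: "two_sided_ideal U"
  shows "C_mod (left_ann U) = {c. \<forall>x\<in>U. (c * x = 0 \<longrightarrow> x = 0) \<and> (x * c = 0 \<longrightarrow> x = 0)}"
proof (intro equalityI subsetI)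
  fix c assume "c \<in> C_mod (left_ann U)"
  note c = C_modD[OF this]
  have "0 \<in> left_ann U" by (rule left_idealD(1)[OF left_ideal_left_ann])
  then have "x = 0" if "x \<in> U" "c * x = 0 \<or> x * c = 0" for x
    using Int_left_ann[OF U that(1)] c[of x] that(2) by auto
  then show "c \<in> {c. \<forall>x\<in>U. (c * x = 0 \<longrightarrow> x = 0) \<and> (x * c = 0 \<longrightarrow> x = 0)}" by blast
next
  fix c assume c: "c \<in> {c. \<forall>x\<in>U. (c * x = 0 \<longrightarrow> x = 0) \<and> (x * c = 0 \<longrightarrow> x = 0)}"
  have UU: "x * u \<in> U" "u * x \<in> U" if "u \<in> U" for x u
    using U that by (auto simp: two_sided_ideal_def left_ideal_def)
  \<comment> \<open>Multiplying \<open>x\<close> by elements of \<open>U\<close> brings it into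
    \<open>U\<close>, where \<open>c\<close> cancels; the other case multiplies from the other
    side.\<close>
  have "x \<in> left_ann U" if "c * x \<in> left_ann U" for x
  proof -
    have "x * u = 0" if "u \<in> U" for u
    proof -
      have "c * (x * u) = 0" using \<open>c * x \<in> left_ann U\<close> that by (auto simp: left_ann_def mult.assoc)
      then show ?thesis using c UU(1)[OF that] by blast
    qed
    then show ?thesis by (simp add: left_ann_def)
  qed
  moreover have "x \<in> left_ann U" if "x * c \<in> left_ann U" for x
  proof -
    have "u * x = 0" if "u \<in> U" for u
    proof -
      have "u * (x * c) = 0" using \<open>x * c \<in> left_ann U\<close> that left_ann_iff_right[OF U] by blast
      then have "(u * x) * c = 0" by (simp add: mult.assoc)
      then show ?thesis using c UU(2)[OF that] by blast
    qed
    then show ?thesis using left_ann_iff_right[OF U] by blast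
  qed
  ultimately show "c \<in> C_mod (left_ann U)" by (rule C_modI)
qed

lemma regular_subset_C_mod:
  "two_sided_ideal (U :: 'a set) \<Longrightarrow> regular_elems \<subseteq> C_mod (left_ann U)"
  unfolding C_mod_left_ann regular_elems_def by blast

text \<open>\<open>U + left_ann U\<close> is essential, as an element outside
  \<open>left_ann U\<close> is moved to a nonzero element of \<open>U\<close> by some
  \<open>u\<close>. In the resulting regular \<open>u + p\<close> the summand \<open>p\<close> acts
  on \<open>U\<close> as zero, so \<open>u\<close> alone is regular on \<open>U\<close>. Such a
  \<open>u\<close> later pulls arbitrary elements into \<open>U\<close>.\<close>

lemma ex_regular_decomposition:
  fixes U :: "'a set"
  assumes U: "two_sided_ideal U"
  obtains u p where "u \<in> U" "p \<in> left_ann U" "u + p \<in> regular_elems" "u \<in> C_mod (left_ann U)"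
proof -
  let ?L = "{u + p | u p. u \<in> U \<and> p \<in> left_ann U}"
  have lU: "left_ideal U" using U by (simp add: two_sided_ideal_def)
  note UD = left_idealD[OF lU] and PD = left_idealD[OF left_ideal_left_ann[of U]]
  have "left_ideal ?L"
    unfolding left_ideal_def
  proof (intro conjI ballI allI impI)
    show "0 \<in> ?L" using UD(1) PD(1) by force
  next
    fix x y assume "x \<in> ?L" "y \<in> ?L"
    then obtain u p v q where "x = u + p" "y = v + q" "u \<in> U" "v \<in> U" "p \<in> left_ann U" "q \<in> left_ann U"
      by blast
    moreover have "u + p + (v + q) = (u + v) + (p + q)" by simp
    ultimately show "x + y \<in> ?L" using UD(2) PD(2) by blast
  next
    fix x assume "x \<in> ?L"
    then obtain u p where "x = u + p" "u \<in> U" "p \<in> left_ann U" by blast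
    moreover have "- (u + p) = - u + - p" by simp
    ultimately show "- x \<in> ?L" using UD(3) PD(3) by blast
  next
    fix r x assume "x \<in> ?L"
    then show "r * x \<in> ?L" using UD(4) PD(4) distrib_left by blast
  qed
  moreover have "essential_in UNIV ?L"
    unfolding essential_in_def
  proof (intro ballI impI)
    fix x :: 'a assume "x \<noteq> 0"
    show "\<exists>r. r * x \<in> ?L \<and> r * x \<noteq> 0"
    proof (cases "x \<in> left_ann U")
      case True
      then have "0 + x \<in> ?L" using UD(1) by blast
      then show ?thesis using \<open>x \<noteq> 0\<close> by (intro exI[of _ 1]) simp
    next
      case False
      then obtain u where u: "u \<in> U" "u * x \<noteq> 0" using left_ann_iff_right[OF U] by blast
      then have "u * x \<in> U" using U by (auto simp: two_sided_ideal_def)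
      then have "u * x + 0 \<in> ?L" using PD(1) by blast
      then show ?thesis using u by (intro exI[of _ u]) simp
    qed
  qed
  ultimately obtain c where "c \<in> ?L" "c \<in> regular_elems" using essential_contains_regular by blast
  then obtain u p where up: "u \<in> U" "p \<in> left_ann U" "u + p \<in> regular_elems" by blast
  have p: "p * x = 0" "x * p = 0" if "x \<in> U" for x
    using up(2) left_ann_iff_right[OF U] that by (auto simp: left_ann_def)
  have "x = 0" if "x \<in> U" "u * x = 0 \<or> x * u = 0" for x
  proof -
    have "(u + p) * x = 0 \<or> x * (u + p) = 0" using p[OF that(1)] that(2) by (simp add: distrib_left distrib_right)
    then show ?thesis using up(3) unfolding regular_elems_def by blast
  qed
  then have "u \<in> C_mod (left_ann U)" unfolding C_mod_left_ann[OF U] by blast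
  then show thesis using that up by blast
qed

lemma left_denom_set_C_mod:
  fixes U :: "'a set"
  assumes U: "minimal_closed U"
  shows "left_denom_set (C_mod (left_ann U))"
proof -
  note U' = minimal_closedD[OF U]
  let ?P = "left_ann U" and ?S = "C_mod (left_ann U)"
  obtain u p where up: "u \<in> U" "p \<in> ?P" "u + p \<in> regular_elems" "u \<in> ?S"
    using ex_regular_decomposition[OF U'(1)] .
  have P: "two_sided_ideal ?P" using two_sided_ideal_left_ann[OF U'(1)] .
  have mult: "s * t \<in> ?S" if "s \<in> ?S" "t \<in> ?S" for s t
  proof (rule C_modI)
    fix x
    show "x \<in> ?P" if "s * t * x \<in> ?P"
      using C_modD(1)[OF \<open>t \<in> ?S\<close> C_modD(1)[OF \<open>s \<in> ?S\<close>]] that by (simp add: mult.assoc)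
    show "x \<in> ?P" if "x * (s * t) \<in> ?P"
      using C_modD(2)[OF \<open>s \<in> ?S\<close> C_modD(2)[OF \<open>t \<in> ?S\<close>]] that by (simp add: mult.assoc)
  qed
  have "1 \<in> ?S" by (simp add: C_mod_def)
  moreover have "0 \<notin> ?S" using U'(5) by (auto simp: C_mod_left_ann[OF U'(1)])
  ultimately have "mult_set ?S" using mult by (simp add: mult_set_def)
  moreover have "\<exists>t\<in>?S. \<exists>r'. t * r = r' * s" if s: "s \<in> ?S" for r s
  proof -
    \<comment> \<open>\<open>s\<close> is known to cancel only on \<open>U\<close>; the summand
      \<open>p\<close> takes care of the annihilator side, so that right multiplication by
      \<open>?s\<close> is injective on the whole ring.\<close>
    let ?s = "u * s + p"
    have "x = 0" if x: "x * ?s = 0" for x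
    proof -
      have eq: "x * u * s = - (x * p)" using x by (simp add: distrib_left mult.assoc eq_neg_iff_add_eq_0)
      have in_U: "x * u \<in> U" "x * u * s \<in> U" using up(1) U'(6,7) by blast+
      have "x * p \<in> ?P" using up(2) left_idealD(4)[OF left_ideal_left_ann] by blast
      then have "x * u * s \<in> ?P" using eq left_idealD(3)[OF left_ideal_left_ann] by metis
      then have "x * u * s = 0" using in_U Int_left_ann[OF U'(1)] by blast
      moreover then have "x * u = 0" using s in_U(1) unfolding C_mod_left_ann[OF U'(1)] by blast
      ultimately have "x * (u + p) = 0" using eq by (simp add: distrib_left)
      then show "x = 0" using up(3) unfolding regular_elems_def by blast
    qed
    then have ess: "essential_in UNIV (range (\<lambda>x. x * ?s))"
      using essential_in_right_multiples[OF dim left_ideal_UNIV] by blast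
    \<comment> \<open>The multipliers carrying \<open>u * r\<close> into the essential left ideal
      \<open>R ?s\<close>. This preimage is again essential, so it contains a regular
      \<open>d\<close>.\<close>
    let ?L = "{x. x * (u * r) \<in> range (\<lambda>x. x * ?s)}"
    note RD = left_idealD[OF left_ideal_principal[of ?s]]
    have "left_ideal ?L"
      unfolding left_ideal_def
    proof (intro conjI ballI allI impI)
      show "0 \<in> ?L" using RD(1) by simp
    next
      fix x y assume "x \<in> ?L" "y \<in> ?L"
      then show "x + y \<in> ?L" using RD(2) by (simp add: distrib_right)
    next
      fix x assume "x \<in> ?L"
      then show "- x \<in> ?L" using RD(3)[of "x * (u * r)"] by simp
    next
      fix q x assume "x \<in> ?L"
      then show "q * x \<in> ?L" using RD(4)[of "x * (u * r)" q] by (simp add: mult.assoc)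
    qed
    moreover have "essential_in UNIV ?L"
      unfolding essential_in_def
    proof (intro ballI impI)
      fix x :: 'a assume "x \<noteq> 0"
      show "\<exists>q. q * x \<in> ?L \<and> q * x \<noteq> 0"
      proof (cases "x * (u * r) = 0")
        case True
        then show ?thesis using \<open>x \<noteq> 0\<close> RD(1) by (intro exI[of _ 1]) simp
      next
        case False
        then obtain q where "q * (x * (u * r)) \<in> range (\<lambda>x. x * ?s)" "q * (x * (u * r)) \<noteq> 0"
          using essential_inE[OF ess] by blast
        then show ?thesis by (intro exI[of _ q]) (auto simp: mult.assoc[symmetric])
      qed
    qed
    ultimately obtain d where d: "d \<in> ?L" "d \<in> regular_elems" using essential_contains_regular by blast
    then obtain y where y: "d * (u * r) = y * ?s" by auto
    \<comment> \<open>The left side lies in \<open>U\<close> and the right side in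
      \<open>?P\<close>, so both vanish.\<close>
    then have "d * (u * r) - y * (u * s) = y * p" by (simp add: distrib_left)
    moreover have "d * (u * r) - y * (u * s) \<in> U"
      by (intro left_ideal_diff[OF U'(2)] U'(6,7) up(1))
    moreover have "y * p \<in> ?P" using up(2) left_idealD(4)[OF left_ideal_left_ann] by blast
    ultimately have "d * (u * r) - y * (u * s) = 0" using Int_left_ann[OF U'(1)] by metis
    then have "(d * u) * r = (y * u) * s" by (simp add: mult.assoc)
    moreover have "d * u \<in> ?S" using mult d(2) up(4) regular_subset_C_mod[OF U'(1)] by blast
    ultimately show ?thesis by blast
  qed
  moreover have "\<exists>t\<in>?S. t * r = 0" if "s \<in> ?S" "r * s = 0" for r s
  proof -
    have "r * s \<in> ?P" using that left_idealD(1)[OF left_ideal_left_ann] by simp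
    then have "r \<in> ?P" by (rule C_modD(2)[OF that(1)])
    \<comment> \<open>The single element \<open>u\<close> serves as left witness for every
      \<open>r \<in> ?P\<close>.\<close>
    then have "u * r = 0" using left_ann_iff_right[OF U'(1)] up(1) by blast
    then show ?thesis using up(4) by blast
  qed
  ultimately show ?thesis unfolding left_denom_set_def by blast
qed

section \<open>Sets contained in some C(P)\<close>

lemma ex_C_mod_superset:
  fixes I S :: "'a set"
  assumes I: "two_sided_ideal I" and no_reg: "I \<inter> regular_elems = {}"
    and S: "\<And>s x. s \<in> S \<Longrightarrow> s * x = 0 \<Longrightarrow> x \<in> I" "\<And>s x. s \<in> S \<Longrightarrow> x * s = 0 \<Longrightarrow> x \<in> I"
  obtains U where "minimal_closed U" "S \<subseteq> C_mod (left_ann U)"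
proof -
  have "left_ann I \<noteq> {0}"
  proof
    assume "left_ann I = {0}"
    \<comment> \<open>With zero annihilator, every \<open>u \<noteq> 0\<close> has a nonzero
      multiple \<open>r * u\<close> with \<open>r \<in> I\<close>. This makes \<open>I\<close>
      essential, so it would contain a regular element.\<close>
    then have "\<exists>r\<in>I. r * u \<noteq> 0" if "u \<noteq> 0" for u
      using left_ann_iff_right[OF I, of u] that by blast
    then have "essential_in UNIV I"
      using I unfolding essential_in_def two_sided_ideal_def by blast
    then show False using essential_contains_regular I no_reg by (metis disjoint_iff two_sided_ideal_def)
  qed
  then obtain U where U: "minimal_closed U" "U \<subseteq> left_ann I"
    using ex_minimal_closed closed_ideal_left_ann[OF I] by blast
  have "x = 0" if "x \<in> U" "x \<in> I" for x using Int_left_ann[OF I] U(2) that by blast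
  then have "S \<subseteq> C_mod (left_ann U)"
    using S unfolding C_mod_left_ann[OF minimal_closedD(1)[OF U(1)]] by blast
  then show thesis using that U by blast
qed

lemma left_denom_set_subset_C_mod:
  fixes S :: "'a set"
  assumes S: "left_denom_set S"
  obtains U where "minimal_closed U" "S \<subseteq> C_mod (left_ann U)"
proof -
  have m: "1 \<in> S" "0 \<notin> S" "\<And>s t. s \<in> S \<Longrightarrow> t \<in> S \<Longrightarrow> s * t \<in> S"
    and ore: "\<And>r s. s \<in> S \<Longrightarrow> \<exists>t\<in>S. \<exists>r'. t * r = r' * s"
    and rev: "\<And>r s. s \<in> S \<Longrightarrow> r * s = 0 \<Longrightarrow> \<exists>t\<in>S. t * r = 0"
    using S by (auto simp: left_denom_set_def mult_set_def)
  \<comment> \<open>The kernel of the localization in elementwise form. Reversibility adds the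
    elements that \<open>S\<close> kills from the right.\<close>
  define I where "I = {r. \<exists>t\<in>S. t * r = 0}"
  have "two_sided_ideal I"
    unfolding two_sided_ideal_def left_ideal_def
  proof (intro conjI ballI allI impI)
    show "0 \<in> I" using m(1) by (auto simp: I_def)
  next
    fix x y assume "x \<in> I" "y \<in> I"
    then obtain s t where st: "s \<in> S" "t \<in> S" "s * x = 0" "t * y = 0" by (auto simp: I_def)
    \<comment> \<open>\<open>r\<close> need not belong to \<open>S\<close>, but \<open>q * s\<close>
      does, and it kills both \<open>x\<close> and \<open>y\<close>.\<close>
    obtain q r where qr: "q \<in> S" "q * s = r * t" using ore[OF st(2)] by blast
    have "q * s * x = 0" using st(3) by (simp add: mult.assoc)
    moreover have "q * s * y = 0" using st(4) qr(2) by (simp add: mult.assoc)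
    ultimately have "(q * s) * (x + y) = 0" by (simp add: distrib_left)
    then show "x + y \<in> I" using m(3) qr(1) st(1) by (auto simp: I_def)
  next
    fix x assume "x \<in> I" then show "- x \<in> I" by (auto simp: I_def)
  next
    fix r x assume "x \<in> I"
    then obtain s where s: "s \<in> S" "s * x = 0" by (auto simp: I_def)
    obtain t q where t: "t \<in> S" "t * r = q * s" using ore[OF s(1)] by blast
    have "t * (r * x) = 0" using s(2) t(2) by (metis mult.assoc mult_zero_right)
    then show "r * x \<in> I" using t(1) by (auto simp: I_def)
  next
    fix r x assume "x \<in> I"
    then obtain t where "t \<in> S" "t * x = 0" by (auto simp: I_def)
    then have "t * (x * r) = 0" by (simp add: mult.assoc[symmetric])
    then show "x * r \<in> I" using \<open>t \<in> S\<close> by (auto simp: I_def)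
  qed
  moreover have "I \<inter> regular_elems = {}" using m(2) by (auto simp: I_def regular_elems_def)
  moreover have "x \<in> I" if "s \<in> S" "s * x = 0" for s x using that by (auto simp: I_def)
  moreover have "x \<in> I" if "s \<in> S" "x * s = 0" for s x using that rev by (auto simp: I_def)
  ultimately show thesis using ex_C_mod_superset that by blast
qed

text \<open>Distinct minimal closed ideals meet in zero, so their product is zero. An element of
  \<open>U\<close> regular modulo \<open>left_ann U\<close> therefore kills \<open>V\<close> and is
  not regular modulo \<open>left_ann V\<close>.\<close>

lemma C_mod_subset_imp_eq:
  fixes U V :: "'a set"
  assumes U: "minimal_closed U" and V: "minimal_closed V"
    and sub: "C_mod (left_ann U) \<subseteq> C_mod (left_ann V)"
  shows "U = V"
proof (rule ccontr)
  assume "U \<noteq> V"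
  note U' = minimal_closedD[OF U] and V' = minimal_closedD[OF V]
  have "closed_ideal (U \<inter> V)" using closed_ideal_Int U'(3) V'(3) by blast
  then have UV: "U \<inter> V = {0}" using U V \<open>U \<noteq> V\<close> unfolding minimal_closed_def by blast
  obtain u p where u: "u \<in> U" "u \<in> C_mod (left_ann U)"
    using ex_regular_decomposition[OF U'(1)] by metis
  obtain v where v: "v \<in> V" "v \<noteq> 0" using V'(5) by blast
  have "u * v = 0" using UV U'(6)[OF u(1)] V'(7)[OF v(1)] by blast
  then show False using v u(2) sub unfolding C_mod_left_ann[OF V'(1)] by blast
qed

text \<open>Here the kernel is known only through \<open>loc_eq\<close>; invertibility of
  \<open>s\<close> in the localization makes it contain everything that \<open>s\<close> kills from
  either side.\<close>

lemma left_localizable_subset_C_mod: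
  fixes S :: "'a set"
  assumes S: "left_localizable S" and reg: "regular_elems \<subseteq> S"
  obtains U where "minimal_closed U" "S \<subseteq> C_mod (left_ann U)"
proof -
  define I where "I = {r. loc_eq S (RConst r) RZero}"
  have I_mult: "r * x * q \<in> I" if "x \<in> I" for r x q
  proof -
    have "loc_eq S (RConst (r * x * q)) (RMul (RConst (r * x)) (RConst q))" by (rule loc_eq.const_mul)
    also have "loc_eq S \<dots> (RMul (RMul (RConst r) (RConst x)) (RConst q))"
      by (intro loc_eq.cong_mul loc_eq.const_mul loc_eq.refl)
    also have "loc_eq S \<dots> (RMul (RMul (RConst r) RZero) (RConst q))"
      using that by (intro loc_eq.cong_mul loc_eq.refl) (simp add: I_def)
    also have "loc_eq S \<dots> (RMul RZero (RConst q))"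
      by (intro loc_eq.cong_mul loc_eq_mult_zero loc_eq.refl)
    also have "loc_eq S \<dots> RZero" by (rule loc_eq_zero_mult)
    finally show ?thesis by (simp add: I_def)
  qed
  have "two_sided_ideal I"
    unfolding two_sided_ideal_def left_ideal_def
  proof (intro conjI ballI allI impI)
    show "0 \<in> I" by (simp add: I_def loc_eq.const_zero)
  next
    fix x y assume "x \<in> I" "y \<in> I"
    then have xy: "loc_eq S (RConst x) RZero" "loc_eq S (RConst y) RZero" by (simp_all add: I_def)
    have "loc_eq S (RConst (x + y)) (RAdd (RConst x) (RConst y))" by (rule loc_eq.const_add)
    also have "loc_eq S \<dots> (RAdd RZero RZero)" using xy by (rule loc_eq.cong_add)
    also have "loc_eq S \<dots> RZero" by (rule loc_eq.add_zero)
    finally show "x + y \<in> I" by (simp add: I_def)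
  next
    fix x assume "x \<in> I" then show "- x \<in> I" using I_mult[of x "- 1" 1] by simp
  next
    fix r x assume "x \<in> I" then show "r * x \<in> I" using I_mult[of x r 1] by simp
  next
    fix r x assume "x \<in> I" then show "x * r \<in> I" using I_mult[of x 1 r] by simp
  qed
  moreover have "I \<inter> regular_elems = {}"
  proof -
    have False if c: "c \<in> I" "c \<in> S" for c
    proof -
      have "loc_eq S ROne (RMul (X c) (RConst c))" using c by (intro loc_eq.sym[OF loc_eq.inv_l])
      also have "loc_eq S \<dots> (RMul (X c) RZero)"
        using c by (intro loc_eq.cong_mul loc_eq.refl) (simp add: I_def)
      also have "loc_eq S \<dots> RZero" by (rule loc_eq_mult_zero)
      finally show False using S by (simp add: left_localizable_def)
    qed
    then show ?thesis using reg by blast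
  qed
  moreover have "x \<in> I" if "s \<in> S" "s * x = 0" for s x
  proof -
    have "loc_eq S (RConst x) (RMul ROne (RConst x))" by (rule loc_eq.sym[OF loc_eq.mul_one_l])
    also have "loc_eq S \<dots> (RMul (RMul (X s) (RConst s)) (RConst x))"
      using that by (intro loc_eq.cong_mul loc_eq.refl loc_eq.sym[OF loc_eq.inv_l])
    also have "loc_eq S \<dots> (RMul (X s) (RMul (RConst s) (RConst x)))" by (rule loc_eq.mul_assoc)
    also have "loc_eq S \<dots> (RMul (X s) (RConst (s * x)))"
      by (intro loc_eq.cong_mul loc_eq.refl loc_eq.sym[OF loc_eq.const_mul])
    also have "loc_eq S \<dots> (RMul (X s) RZero)"
      unfolding that(2) by (intro loc_eq.cong_mul loc_eq.refl loc_eq.const_zero)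
    also have "loc_eq S \<dots> RZero" by (rule loc_eq_mult_zero)
    finally show ?thesis by (simp add: I_def)
  qed
  moreover have "x \<in> I" if "s \<in> S" "x * s = 0" for s x
  proof -
    have "loc_eq S (RConst x) (RMul (RConst x) ROne)" by (rule loc_eq.sym[OF loc_eq.mul_one_r])
    also have "loc_eq S \<dots> (RMul (RConst x) (RMul (RConst s) (X s)))"
      using that by (intro loc_eq.cong_mul loc_eq.refl loc_eq.sym[OF loc_eq.inv_r])
    also have "loc_eq S \<dots> (RMul (RMul (RConst x) (RConst s)) (X s))"
      by (rule loc_eq.sym[OF loc_eq.mul_assoc])
    also have "loc_eq S \<dots> (RMul (RConst (x * s)) (X s))"
      by (intro loc_eq.cong_mul loc_eq.refl loc_eq.sym[OF loc_eq.const_mul])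
    also have "loc_eq S \<dots> (RMul RZero (X s))"
      unfolding that(2) by (intro loc_eq.cong_mul loc_eq.refl loc_eq.const_zero)
    also have "loc_eq S \<dots> RZero" by (rule loc_eq_zero_mult)
    finally show ?thesis by (simp add: I_def)
  qed
  ultimately show thesis using ex_C_mod_superset that by blast
qed

text \<open>Agreement of partial maps on their common domain is transitive only because domains are
  essential and the singular ideal vanishes.\<close>
lemma loc_eq_imp_partial_map_agree:
  fixes U S :: "'a set"
  assumes U: "two_sided_ideal U" and S: "\<And>s x. s \<in> S \<Longrightarrow> x \<in> U \<Longrightarrow> x * s = 0 \<Longrightarrow> x = 0"
    and e: "loc_eq S e e'" and maps: "partial_map U S e x y" "partial_map U S e' x y'"
  shows "y = y'"
proof -
  have sv: "z = w" if "partial_map U S e x z" "partial_map U S e x w" for e x z w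
    by (rule partial_map_unique[OF U S that])
  have canc: "x = y" if "s \<in> S" "x \<in> U" "y \<in> U" "x * s = y * s" for s x y
  proof -
    have "(x - y) * s = 0" using that(4) by (simp add: left_diff_distrib)
    moreover have "x - y \<in> U"
      using U that left_ideal_diff unfolding two_sided_ideal_def by blast
    ultimately show ?thesis using S[OF that(1)] by fastforce
  qed
  show ?thesis
    using e maps
  proof (induction arbitrary: x y y' rule: loc_eq.induct)
    case (refl a)
    show ?case by (rule sv[OF refl.prems])
  next
    case (sym a b)
    show ?case by (rule sym.IH[OF sym.prems(2,1), symmetric])
  next
    \<comment> \<open>The middle term \<open>b\<close> may be undefined at \<open>x\<close>. Scaling
      \<open>u * x\<close> into the essential domain of \<open>b\<close> makes both induction
      hypotheses applicable, and they put a nonzero multiple of \<open>u\<close> into the left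
      annihilator of \<open>y - y'\<close>.\<close>
    case (trans a b c)
    have "y - y' = 0"
    proof (rule singular_zero, unfold essential_in_def, intro ballI impI)
      fix u :: 'a assume "u \<noteq> 0"
      note ab = partial_map_mult[OF U trans.prems(1)] partial_map_mult[OF U trans.prems(2)]
      show "\<exists>r. r * u \<in> left_ann {y - y'} \<and> r * u \<noteq> 0"
      \<comment> \<open>A zero argument needs no scaling: every map sends \<open>0\<close> only to
        \<open>0\<close>, so \<open>u\<close> itself annihilates \<open>y - y'\<close>.\<close>
      proof (cases "u * x = 0")
        case True
        then have "u * y = 0" "u * y' = 0"
          using ab[of u] sv[OF _ partial_map_zero[OF U]] by auto
        then show ?thesis using \<open>u \<noteq> 0\<close>
          by (intro exI[of _ 1]) (simp add: left_ann_def right_diff_distrib)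
      next
        case False
        have "u * x \<in> U" using partial_map_in[OF U ab(1)] by blast
        obtain r where r: "r * (u * x) \<in> {x. \<exists>y. partial_map U S b x y}" "r * (u * x) \<noteq> 0"
          by (rule essential_inE[OF partial_map_essential[where e = b, OF U S dim] \<open>u * x \<in> U\<close> False])
        then obtain z where z: "partial_map U S b (r * u * x) z" by (auto simp: mult.assoc)
        have "partial_map U S a (r * u * x) (r * u * y)" "partial_map U S c (r * u * x) (r * u * y')"
          by (rule partial_map_mult[OF U trans.prems(1)] partial_map_mult[OF U trans.prems(2)])+
        then have "r * u * y = z" "z = r * u * y'"
          using trans.IH(1)[OF _ z] trans.IH(2)[OF z] by blast+
        then have "r * u * (y - y') = 0" by (simp add: right_diff_distrib)
        moreover have "r * u \<noteq> 0" using r(2) by (auto simp: mult.assoc[symmetric])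
        ultimately show ?thesis by (auto simp: left_ann_def)
      qed
    qed
    then show ?case by simp
  next
    case (cong_add a a' b b')
    obtain y1 y2 where "partial_map U S a x y1" "partial_map U S b x y2" "y = y1 + y2"
      using cong_add.prems(1) by auto
    moreover obtain z1 z2 where "partial_map U S a' x z1" "partial_map U S b' x z2" "y' = z1 + z2"
      using cong_add.prems(2) by auto
    ultimately show ?case using cong_add.IH by metis
  next
    case (cong_mul a a' b b')
    obtain u where u: "partial_map U S a x u" "partial_map U S b u y" using cong_mul.prems(1) by auto
    obtain v where v: "partial_map U S a' x v" "partial_map U S b' v y'" using cong_mul.prems(2) by auto
    show ?case using cong_mul.IH(1)[OF u(1) v(1)] cong_mul.IH(2)[OF u(2)] v(2) by simp
  next
    case (cong_neg a a')
    then show ?case by auto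
  next
    case (distrib_l a b c)
    obtain u y1 y2 where u: "partial_map U S a x u" "partial_map U S b u y1" "partial_map U S c u y2"
      "y = y1 + y2" using distrib_l.prems(1) by auto
    obtain v w z1 z2 where v: "partial_map U S a x v" "partial_map U S b v z1"
      "partial_map U S a x w" "partial_map U S c w z2" "y' = z1 + z2" using distrib_l.prems(2) by auto
    have "v = u" "w = u" using sv u(1) v(1,3) by auto
    then show ?case using sv[OF u(2)] sv[OF u(3)] u(4) v(2,4,5) by simp
  next
    case (distrib_r a b c)
    obtain z1 z2 where z: "partial_map U S a x z1" "partial_map U S b x z2" "partial_map U S c (z1 + z2) y"
      using distrib_r.prems(1) by auto
    obtain w1 w2 y1 y2 where w: "partial_map U S a x w1" "partial_map U S c w1 y1"
      "partial_map U S b x w2" "partial_map U S c w2 y2" "y' = y1 + y2"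
      using distrib_r.prems(2) by auto
    have "w1 = z1" "w2 = z2" using sv z(1,2) w(1,3) by auto
    then show ?case using partial_map_add[OF U w(2,4)] sv[OF z(3)] w(5) by simp
  next
    case (add_assoc a b c)
    obtain y1 y2 y3 where y: "partial_map U S a x y1" "partial_map U S b x y2" "partial_map U S c x y3"
      "y = y1 + y2 + y3" using add_assoc.prems(1) by auto
    obtain z1 z2 z3 where z: "partial_map U S a x z1" "partial_map U S b x z2" "partial_map U S c x z3"
      "y' = z1 + (z2 + z3)" using add_assoc.prems(2) by auto
    show ?case using sv[OF y(1) z(1)] sv[OF y(2) z(2)] sv[OF y(3) z(3)] y(4) z(4)
      by (simp add: add.assoc)
  next
    case (add_comm a b)
    obtain y1 y2 where y: "partial_map U S a x y1" "partial_map U S b x y2" "y = y1 + y2"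
      using add_comm.prems(1) by auto
    obtain z1 z2 where z: "partial_map U S a x z1" "partial_map U S b x z2" "y' = z2 + z1"
      using add_comm.prems(2) by auto
    show ?case using sv[OF y(1) z(1)] sv[OF y(2) z(2)] y(3) z(3) by (simp add: add.commute)
  next
    case (mul_assoc a b c)
    obtain u v where u: "partial_map U S a x u" "partial_map U S b u v" "partial_map U S c v y"
      using mul_assoc.prems(1) by auto
    obtain u' v' where v: "partial_map U S a x u'" "partial_map U S b u' v'" "partial_map U S c v' y'"
      using mul_assoc.prems(2) by auto
    have "u' = u" by (rule sv[OF v(1) u(1)])
    then have "v' = v" using sv[OF _ u(2)] v(2) by simp
    then show ?case using sv[OF u(3)] v(3) by simp
  next
    case (add_neg a)
    then show ?case by (auto dest: sv)
  next
    case (inv_r s)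
    then show ?case using canc by auto
  next
    case (add_zero a)
    then show ?case by (auto dest: sv)
  next
    case (mul_one_l a)
    then show ?case by (auto dest: sv)
  next
    case (mul_one_r a)
    then show ?case by (auto dest: sv)
  next
    case (inv_l s)
    then show ?case by auto
  qed (simp_all add: distrib_left mult.assoc)
qed

text \<open>\<open>ROne\<close> and \<open>RZero\<close> act on all of \<open>U\<close>, as identity
  and zero, so their equality would force a nonzero \<open>u \<in> U\<close> to vanish. The fraction
  form comes from the Ore condition.\<close>

lemma left_localizable_C_mod:
  fixes U :: "'a set"
  assumes U: "minimal_closed U"
  shows "left_localizable (C_mod (left_ann U))"
proof -
  note U' = minimal_closedD[OF U]
  let ?S = "C_mod (left_ann U)"
  have canc: "x = 0" if "s \<in> ?S" "x \<in> U" "x * s = 0" for s x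
    using that unfolding C_mod_left_ann[OF U'(1)] by blast
  obtain u where u: "u \<in> U" "u \<noteq> 0" using U'(5) by blast
  have maps: "partial_map U ?S ROne u u" "partial_map U ?S RZero u 0" using u by simp_all
  have "\<not> loc_eq ?S ROne RZero"
    using loc_eq_imp_partial_map_agree[OF U'(1) canc _ maps] u(2) by auto
  then show ?thesis
    using left_denom_set_C_mod[OF U] left_denom_set_fraction
    unfolding left_localizable_def left_denom_set_def by blast
qed

section \<open>Maximal sets\<close>

lemma max_Den_l_eq: "(max_Den_l :: 'a set set) = (\<lambda>U. C_mod (left_ann U)) ` {U. minimal_closed U}"
proof (intro equalityI subsetI)
  fix S :: "'a set" assume S: "S \<in> max_Den_l"
  then obtain U where U: "minimal_closed U" "S \<subseteq> C_mod (left_ann U)"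
    using left_denom_set_subset_C_mod unfolding max_Den_l_def by blast
  then have "S = C_mod (left_ann U)"
    using S left_denom_set_C_mod[OF U(1)] unfolding max_Den_l_def by blast
  then show "S \<in> (\<lambda>U. C_mod (left_ann U)) ` {U. minimal_closed U}" using U(1) by blast
next
  fix S :: "'a set" assume "S \<in> (\<lambda>U. C_mod (left_ann U)) ` {U. minimal_closed U}"
  then obtain U where U: "minimal_closed U" and S: "S = C_mod (left_ann U)" by blast
  \<comment> \<open>A larger \<open>T\<close> lies below some \<open>C_mod (left_ann V)\<close>, and
    incomparability collapses the chain; no maximal set has to be produced by Zorn's lemma.\<close>
  have False if T: "left_denom_set T" "S \<subset> T" for T
  proof -
    obtain V where V: "minimal_closed V" "T \<subseteq> C_mod (left_ann V)"
      using left_denom_set_subset_C_mod[OF T(1)] by blast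
    then have "U = V" using C_mod_subset_imp_eq[OF U] T(2) S by blast
    then show False using V T(2) S by blast
  qed
  then show "S \<in> max_Den_l" using left_denom_set_C_mod[OF U] S unfolding max_Den_l_def by blast
qed

lemma max_L_l_over_regular_eq:
  "{S :: 'a set. S \<in> max_L_l \<and> regular_elems \<subseteq> S} = (\<lambda>U. C_mod (left_ann U)) ` {U. minimal_closed U}"
proof (intro equalityI subsetI)
  fix S :: "'a set" assume "S \<in> {S. S \<in> max_L_l \<and> regular_elems \<subseteq> S}"
  then have S: "S \<in> max_L_l" "regular_elems \<subseteq> S" by blast+
  then obtain U where U: "minimal_closed U" "S \<subseteq> C_mod (left_ann U)"
    using left_localizable_subset_C_mod unfolding max_L_l_def by blast
  then have "S = C_mod (left_ann U)"
    using S(1) left_localizable_C_mod[OF U(1)] unfolding max_L_l_def by blast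
  then show "S \<in> (\<lambda>U. C_mod (left_ann U)) ` {U. minimal_closed U}" using U(1) by blast
next
  fix S :: "'a set" assume "S \<in> (\<lambda>U. C_mod (left_ann U)) ` {U. minimal_closed U}"
  then obtain U where U: "minimal_closed U" and S: "S = C_mod (left_ann U)" by blast
  have reg: "regular_elems \<subseteq> S" using regular_subset_C_mod minimal_closedD(1)[OF U] S by blast
  have False if T: "left_localizable T" "S \<subset> T" for T
  proof -
    \<comment> \<open>Maximality in \<open>max_L_l\<close> is among all localizable sets. A
      competitor above \<open>S\<close> inherits the regular elements, so the upper bound applies to
      it.\<close>
    have "regular_elems \<subseteq> T" using reg T(2) by blast
    then obtain V where V: "minimal_closed V" "T \<subseteq> C_mod (left_ann V)"
      using left_localizable_subset_C_mod[OF T(1)] by blast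
    then have "U = V" using C_mod_subset_imp_eq[OF U] T(2) S by blast
    then show False using V T(2) S by blast
  qed
  then have "S \<in> max_L_l" using left_localizable_C_mod[OF U] S unfolding max_L_l_def by blast
  then show "S \<in> {S. S \<in> max_L_l \<and> regular_elems \<subseteq> S}" using reg by blast
qed

end

theorem theorem1p12:
  assumes "semiprime_ring TYPE('a::ring_1)"
    and "left_Goldie TYPE('a)"
  shows "{S :: 'a set. S \<in> max_L_l \<and> regular_elems \<subseteq> S} = max_Den_l
         \<and> max_Den_l = {C_mod P | P :: 'a set. P \<in> min_primes}"
proof -
  interpret semiprime_left_Goldie "TYPE('a)"
    using assms by unfold_locales
  show ?thesis
    unfolding max_L_l_over_regular_eq max_Den_l_eq min_primes_eq by blast
qed

end
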